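(* Let $G=\langle S\mid T\rangle$ be a group, where $S$ is a generating set and $T$ is a set of relations (relators). Let $K$ be an algebraic extension of a prime field, $\alpha:G\times G\to K^*$ a normalized $2$-cocycle, and $f:S\to K^\alpha G$ a map. For words $w$ in the letters $S\cup S^{-1}$ define $f^*(w)\in K^\alpha G$ by $$ f^*(w)=\begin{cases} f(w) & \text{if } w\in S,\\ -\dfrac{1}{\alpha(w,w^{-1})}\,\overline{w}\,f(w^{-1})\,\overline{w} & \text{if } w\in S^{-1},\\ 0 & \text{if } w=1,\\ \dfrac{1}{\beta_w}\displaystyle\sum_{i=1}^{k}\Big(\prod_{j=1}^{i-1}\overline{w_j}\Big)f^*(w_i)\Big(\prod_{j=i+1}^{k}\overline{w_j}\Big) & \text{if } w=\prod_{i=1}^k w_i,\ w_i\in S\cup S^{-1}, \end{cases} \qquad \beta_w=\prod_{i=1}^{k-1}\alpha\Big(w_i,\prod_{j=i+1}^{k}w_j\Big). $$ Then: 1. If there exists a derivation of $K^\alpha G$ extending $f$, it is unique and is given by $f^*$ extended by linearity; that is, it sends $\overline{g}$ to $f^*(w)$ for every $g\in G$ and every word $w$ representing $g$. 2. A derivation of $K^\alpha G$ extending $f$ exists if and only if $f^*(T)=0$, i.e. $f^*(t)=0$ for every relator word $t\in T$.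
   Context: A prime field is $\mathbb{Q}$ or $\mathbb{F}_p$ for a prime $p$. A $2$-cocycle is a map $\alpha:G\times G\to K^*$ with $\alpha(x,y)\alpha(xy,z)=\alpha(y,z)\alpha(x,yz)$ for all $x,y,z\in G$; it is normalized if $\alpha(1,g)=\alpha(g,1)=1$ for all $g\in G$. The twisted group ring $K^\alpha G$ is the $K$-vector space with basis $\{\overline{g}:g\in G\}$ and product $(a\overline{g})(b\overline{h})=ab\,\alpha(g,h)\,\overline{gh}$, extended by linearity. A derivation of a ring $A$ is an additive map $d:A\to A$ with $d(ab)=d(a)b+a\,d(b)$ for all $a,b\in A$ (no $K$-linearity is assumed). A derivation $d$ of $K^\alpha G$ extends $f:S\to K^\alpha G$ if $d(\overline{s})=f(s)$ for all $s\in S$. In the formula for $f^*$, the elements of $S\cup S^{-1}$ are treated as formal letters, a bar over a letter denotes the basis element of $K^\alpha G$ attached to the corresponding element of $G$, and arguments of $\alpha$ are evaluated in $G$. The word $1$ is the empty word. *)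

theory Defs
  imports "HOL-Algebra.Algebra" "HOL-Number_Theory.Residues"
begin

section \<open>Words, free groups and group presentations\<close>

datatype 's letter = Gen 's | Inv 's

fun inv_letter :: "'s letter \<Rightarrow> 's letter" where
  "inv_letter (Gen s) = Inv s"
| "inv_letter (Inv s) = Gen s"

definition letters :: "'s set \<Rightarrow> 's letter set" where
  "letters S = Gen ` S \<union> Inv ` S"

definition words :: "'s set \<Rightarrow> 's letter list set" where
  "words S = lists (letters S)"

inductive_set free_equiv :: "'s set \<Rightarrow> ('s letter list \<times> 's letter list) set"
  for S :: "'s set" where
  refl: "w \<in> words S \<Longrightarrow> (w, w) \<in> free_equiv S"
| cancel: "u \<in> words S \<Longrightarrow> v \<in> words S \<Longrightarrow> x \<in> letters S \<Longrightarrow>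
    (u @ [x, inv_letter x] @ v, u @ v) \<in> free_equiv S"
| sym: "(u, v) \<in> free_equiv S \<Longrightarrow> (v, u) \<in> free_equiv S"
| trans: "(u, v) \<in> free_equiv S \<Longrightarrow> (v, w) \<in> free_equiv S \<Longrightarrow> (u, w) \<in> free_equiv S"

definition free_class :: "'s set \<Rightarrow> 's letter list \<Rightarrow> 's letter list set" where
  "free_class S w = free_equiv S `` {w}"

definition free_group :: "'s set \<Rightarrow> 's letter list set monoid" where
  "free_group S =
    \<lparr>carrier = words S // free_equiv S,
     monoid.mult = (\<lambda>A B. \<Union>u\<in>A. \<Union>v\<in>B. free_class S (u @ v)),
     monoid.one = free_class S []\<rparr>"

definition normal_closure :: "('a, 'b) monoid_scheme \<Rightarrow> 'a set \<Rightarrow> 'a set" where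
  "normal_closure F R = \<Inter>{N. N \<lhd> F \<and> R \<subseteq> N}"

text \<open>
  The group G has the presentation with generators S and relators T, where the formal generator
  s stands for the element \<open>\<iota> s\<close> of G: the map \<open>\<iota>\<close> induces a surjection
  from the free group on S onto G whose kernel is the normal closure of T.
  A set of generators inside G is the case that \<open>\<iota>\<close> is the inclusion.
\<close>

definition presentation ::
  "('g, 'm) monoid_scheme \<Rightarrow> 's set \<Rightarrow> ('s \<Rightarrow> 'g) \<Rightarrow> 's letter list set \<Rightarrow> bool" where
  "presentation G S \<iota> T \<longleftrightarrow>
    T \<subseteq> words S \<and>
    (\<exists>\<phi> \<in> hom (free_group S) G.
      (\<forall>s\<in>S. \<phi> (free_class S [Gen s]) = \<iota> s) \<and>
      \<phi> ` carrier (free_group S) = carrier G \<and>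
      kernel (free_group S) G \<phi> = normal_closure (free_group S) (free_class S ` T))"

fun letter_val :: "('g, 'm) monoid_scheme \<Rightarrow> ('s \<Rightarrow> 'g) \<Rightarrow> 's letter \<Rightarrow> 'g" where
  "letter_val G \<iota> (Gen s) = \<iota> s"
| "letter_val G \<iota> (Inv s) = inv\<^bsub>G\<^esub> (\<iota> s)"

definition list_mult :: "('a, 'b) monoid_scheme \<Rightarrow> 'a list \<Rightarrow> 'a" where
  "list_mult M xs = foldr (\<otimes>\<^bsub>M\<^esub>) xs \<one>\<^bsub>M\<^esub>"

definition word_val :: "('g, 'm) monoid_scheme \<Rightarrow> ('s \<Rightarrow> 'g) \<Rightarrow> 's letter list \<Rightarrow> 'g" where
  "word_val G \<iota> w = list_mult G (map (letter_val G \<iota>) w)"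


section \<open>Algebraic extensions of prime fields\<close>

definition rat_ring :: "rat ring" where
  "rat_ring = \<lparr>carrier = UNIV, monoid.mult = (*), monoid.one = 1, ring.zero = 0, ring.add = (+)\<rparr>"

definition prime_field :: "('k, 'n) ring_scheme \<Rightarrow> bool" where
  "prime_field F \<longleftrightarrow>
    F \<simeq> rat_ring \<or> (\<exists>p::nat. Factorial_Ring.prime p \<and> F \<simeq> residue_ring (int p))"

definition algebraic_over_prime_field :: "('k, 'n) ring_scheme \<Rightarrow> bool" where
  "algebraic_over_prime_field K \<longleftrightarrow>
    (\<exists>F. subfield F K \<and> prime_field (K\<lparr>carrier := F\<rparr>) \<and>
      (\<forall>x\<in>carrier K. (ring.algebraic K over F) x))"


section \<open>Cocycles and twisted group rings\<close>

definition normalized_cocycle ::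
  "('k, 'n) ring_scheme \<Rightarrow> ('g, 'm) monoid_scheme \<Rightarrow> ('g \<Rightarrow> 'g \<Rightarrow> 'k) \<Rightarrow> bool" where
  "normalized_cocycle K G \<alpha> \<longleftrightarrow>
    (\<forall>x\<in>carrier G. \<forall>y\<in>carrier G. \<alpha> x y \<in> Units K) \<and>
    (\<forall>x\<in>carrier G. \<forall>y\<in>carrier G. \<forall>z\<in>carrier G.
      \<alpha> x y \<otimes>\<^bsub>K\<^esub> \<alpha> (x \<otimes>\<^bsub>G\<^esub> y) z = \<alpha> y z \<otimes>\<^bsub>K\<^esub> \<alpha> x (y \<otimes>\<^bsub>G\<^esub> z)) \<and>
    (\<forall>g\<in>carrier G. \<alpha> \<one>\<^bsub>G\<^esub> g = \<one>\<^bsub>K\<^esub> \<and> \<alpha> g \<one>\<^bsub>G\<^esub> = \<one>\<^bsub>K\<^esub>)"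

definition supp ::
  "('k, 'n) ring_scheme \<Rightarrow> ('g, 'm) monoid_scheme \<Rightarrow> ('g \<Rightarrow> 'k) \<Rightarrow> 'g set" where
  "supp K G a = {g \<in> carrier G. a g \<noteq> \<zero>\<^bsub>K\<^esub>}"

definition tbasis ::
  "('k, 'n) ring_scheme \<Rightarrow> ('g, 'm) monoid_scheme \<Rightarrow> 'g \<Rightarrow> ('g \<Rightarrow> 'k)" where
  "tbasis K G g = (\<lambda>x\<in>carrier G. if x = g then \<one>\<^bsub>K\<^esub> else \<zero>\<^bsub>K\<^esub>)"

text \<open>
  An element is a finitely supported coefficient function, extensional outside \<open>carrier G\<close>.
  The product is the bilinear extension of the product of basis elements; its unit is the basis
  element of the unit of G because only normalized cocycles are considered.
\<close>

definition twisted_group_ring ::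
  "('k, 'n) ring_scheme \<Rightarrow> ('g, 'm) monoid_scheme \<Rightarrow> ('g \<Rightarrow> 'g \<Rightarrow> 'k) \<Rightarrow> ('k, 'g \<Rightarrow> 'k) module" where
  "twisted_group_ring K G \<alpha> =
    \<lparr>carrier = {a \<in> carrier G \<rightarrow>\<^sub>E carrier K. finite (supp K G a)},
     monoid.mult = (\<lambda>a b. \<lambda>x\<in>carrier G.
       \<Oplus>\<^bsub>K\<^esub>p \<in> {(g, h). g \<in> supp K G a \<and> h \<in> supp K G b \<and> g \<otimes>\<^bsub>G\<^esub> h = x}.
         a (fst p) \<otimes>\<^bsub>K\<^esub> b (snd p) \<otimes>\<^bsub>K\<^esub> \<alpha> (fst p) (snd p)),
     monoid.one = tbasis K G \<one>\<^bsub>G\<^esub>,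
     ring.zero = (\<lambda>x\<in>carrier G. \<zero>\<^bsub>K\<^esub>),
     ring.add = (\<lambda>a b. \<lambda>x\<in>carrier G. a x \<oplus>\<^bsub>K\<^esub> b x),
     module.smult = (\<lambda>c a. \<lambda>x\<in>carrier G. c \<otimes>\<^bsub>K\<^esub> a x)\<rparr>"


section \<open>Derivations\<close>

text \<open>Maps are extensional outside the carrier, so equality of derivations is equality of functions.\<close>

definition derivations :: "('a, 'b) ring_scheme \<Rightarrow> ('a \<Rightarrow> 'a) set" where
  "derivations R = {d \<in> carrier R \<rightarrow>\<^sub>E carrier R.
    (\<forall>a\<in>carrier R. \<forall>b\<in>carrier R. d (a \<oplus>\<^bsub>R\<^esub> b) = d a \<oplus>\<^bsub>R\<^esub> d b) \<and>
    (\<forall>a\<in>carrier R. \<forall>b\<in>carrier R.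
      d (a \<otimes>\<^bsub>R\<^esub> b) = d a \<otimes>\<^bsub>R\<^esub> b \<oplus>\<^bsub>R\<^esub> a \<otimes>\<^bsub>R\<^esub> d b)}"

definition extending_derivations ::
  "('k, 'n) ring_scheme \<Rightarrow> ('g, 'm) monoid_scheme \<Rightarrow> ('g \<Rightarrow> 'g \<Rightarrow> 'k) \<Rightarrow>
   's set \<Rightarrow> ('s \<Rightarrow> 'g) \<Rightarrow> ('s \<Rightarrow> 'g \<Rightarrow> 'k) \<Rightarrow> (('g \<Rightarrow> 'k) \<Rightarrow> ('g \<Rightarrow> 'k)) set" where
  "extending_derivations K G \<alpha> S \<iota> f =
    {d \<in> derivations (twisted_group_ring K G \<alpha>). \<forall>s\<in>S. d (tbasis K G (\<iota> s)) = f s}"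

definition letter_bar ::
  "('k, 'n) ring_scheme \<Rightarrow> ('g, 'm) monoid_scheme \<Rightarrow> ('s \<Rightarrow> 'g) \<Rightarrow> 's letter \<Rightarrow> ('g \<Rightarrow> 'k)" where
  "letter_bar K G \<iota> x = tbasis K G (letter_val G \<iota> x)"

text \<open>Positions are counted from 0, so the indices here are those of the usual formula minus 1.\<close>

definition word_beta ::
  "('k, 'n) ring_scheme \<Rightarrow> ('g, 'm) monoid_scheme \<Rightarrow> ('g \<Rightarrow> 'g \<Rightarrow> 'k) \<Rightarrow> ('s \<Rightarrow> 'g) \<Rightarrow>
   's letter list \<Rightarrow> 'k" where
  "word_beta K G \<alpha> \<iota> w =
    (\<Otimes>\<^bsub>K\<^esub>i \<in> {..<length w - 1}.
      \<alpha> (letter_val G \<iota> (w ! i)) (word_val G \<iota> (drop (Suc i) w)))"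

fun fstar_letter ::
  "('k, 'n) ring_scheme \<Rightarrow> ('g, 'm) monoid_scheme \<Rightarrow> ('g \<Rightarrow> 'g \<Rightarrow> 'k) \<Rightarrow> ('s \<Rightarrow> 'g) \<Rightarrow>
   ('s \<Rightarrow> 'g \<Rightarrow> 'k) \<Rightarrow> 's letter \<Rightarrow> ('g \<Rightarrow> 'k)" where
  "fstar_letter K G \<alpha> \<iota> f (Gen s) = f s"
| "fstar_letter K G \<alpha> \<iota> f (Inv s) =
    (let A = twisted_group_ring K G \<alpha>; w = letter_val G \<iota> (Inv s); w' = letter_val G \<iota> (Gen s)
     in (\<ominus>\<^bsub>K\<^esub> (inv\<^bsub>K\<^esub> (\<alpha> w w'))) \<odot>\<^bsub>A\<^esub>
          (tbasis K G w \<otimes>\<^bsub>A\<^esub> f s \<otimes>\<^bsub>A\<^esub> tbasis K G w))"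

fun fstar ::
  "('k, 'n) ring_scheme \<Rightarrow> ('g, 'm) monoid_scheme \<Rightarrow> ('g \<Rightarrow> 'g \<Rightarrow> 'k) \<Rightarrow> ('s \<Rightarrow> 'g) \<Rightarrow>
   ('s \<Rightarrow> 'g \<Rightarrow> 'k) \<Rightarrow> 's letter list \<Rightarrow> ('g \<Rightarrow> 'k)" where
  "fstar K G \<alpha> \<iota> f [] = \<zero>\<^bsub>twisted_group_ring K G \<alpha>\<^esub>"
| "fstar K G \<alpha> \<iota> f [x] = fstar_letter K G \<alpha> \<iota> f x"
| "fstar K G \<alpha> \<iota> f (x # y # z) =
    (let A = twisted_group_ring K G \<alpha>; w = x # y # z
     in inv\<^bsub>K\<^esub> (word_beta K G \<alpha> \<iota> w) \<odot>\<^bsub>A\<^esub>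
          (\<Oplus>\<^bsub>A\<^esub>i \<in> {..<length w}.
            list_mult A (map (letter_bar K G \<iota>) (take i w)) \<otimes>\<^bsub>A\<^esub>
            fstar_letter K G \<alpha> \<iota> f (w ! i) \<otimes>\<^bsub>A\<^esub>
            list_mult A (map (letter_bar K G \<iota>) (drop (Suc i) w))))"

end

theory Submission
  imports Defs
begin

text \<open>
  Write \<open>A\<close> for the twisted group ring and \<open>bar g\<close> for its basis elements. Adjoin to \<open>A\<close> a central
  \<open>\<epsilon>\<close> with \<open>\<epsilon>\<^sup>2 = 0\<close>. An additive map \<open>d\<close> of \<open>A\<close> is a derivation exactly if \<open>a \<mapsto> a + \<epsilon> d a\<close> is a ring
  homomorphism into \<open>A[\<epsilon>]\<close>. If \<open>d\<close> is \<open>K\<close>-linear, it is determined by the elements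
  \<open>bar g + \<epsilon> d (bar g)\<close>, and the Leibniz rule then says that these multiply in the same way as the
  \<open>bar g\<close>, namely like the elements of \<open>G\<close> up to the scalars \<open>\<alpha> g h\<close>. After division by these
  scalars the elements \<open>bar g + \<epsilon> m\<close> form a group \<open>dual_group\<close>, the pairs \<open>(m, g)\<close>, that projects
  onto \<open>G\<close>; associativity is the cocycle identity. So \<open>K\<close>-linear derivations are the homomorphic sections
  \<open>g \<mapsto> (d (bar g), g)\<close> of this projection: \<open>derivation_hom\<close> gives one direction and
  \<open>linear_extension_derivation\<close> the other.

  The map \<open>f\<^sup>*\<close> is evaluation in this group: a word in the generators \<open>(f s, \<iota> s)\<close> has the value
  \<open>(f\<^sup>* w, g)\<close>, where \<open>g\<close> is its value in \<open>G\<close> (\<open>word_val_dual_group\<close>). The two claims are therefore the two general facts on a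
  presented group. A homomorphism out of \<open>G\<close> is determined by its values on the generators, and the
  generators may be sent to given elements of a group exactly if every relator then has the
  value 1 there (\<open>hom_from_presentation\<close>). For a relator \<open>t\<close> the value is \<open>(f\<^sup>* t, 1)\<close>, so the
  condition reads \<open>f\<^sup>* t = 0\<close>.

  The hypothesis on \<open>K\<close> is what makes every derivation \<open>K\<close>-linear (\<open>derivation_linear\<close>). Each
  coefficient of \<open>c \<mapsto> d (c 1)\<close> is a derivation of the field \<open>K\<close>, and an algebraic extension of a prime
  field has no derivation other than 0 (\<open>der_vanishes\<close>): in characteristic 0 by differentiating an
  algebraic equation, in positive characteristic because every element lies in a finite field.
\<close>

section \<open>Derivations of algebraic extensions of prime fields\<close>

locale field_derivation = field K for K (structure) +
  fixes \<delta>
  assumes der_closed [simp, intro]: "x \<in> carrier K \<Longrightarrow> \<delta> x \<in> carrier K"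
    and der_add: "x \<in> carrier K \<Longrightarrow> y \<in> carrier K \<Longrightarrow> \<delta> (x \<oplus> y) = \<delta> x \<oplus> \<delta> y"
    and der_mult: "x \<in> carrier K \<Longrightarrow> y \<in> carrier K \<Longrightarrow> \<delta> (x \<otimes> y) = \<delta> x \<otimes> y \<oplus> x \<otimes> \<delta> y"
begin

lemma der_zero [simp]: "\<delta> \<zero> = \<zero>"
  using der_add[of \<zero> \<zero>] by (metis add.r_cancel_one' der_closed r_zero zero_closed)

lemma der_one [simp]: "\<delta> \<one> = \<zero>"
  using der_mult[of \<one> \<one>] by (metis add.r_cancel_one' der_closed l_one one_closed r_one)

lemma der_multiple:
  assumes "x \<in> carrier K"
  shows "\<delta> ([(n::nat)] \<cdot> x) = [n] \<cdot> \<delta> x"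
  by (induct n) (use assms in \<open>auto simp: der_add\<close>)

lemma der_pow:
  assumes x: "x \<in> carrier K"
  shows "\<delta> (x [^] Suc n) = [Suc n] \<cdot> (x [^] n \<otimes> \<delta> x)"
proof (induct n)
  case (Suc n)
  have "\<delta> (x [^] Suc (Suc n)) = ([Suc n] \<cdot> (x [^] n \<otimes> \<delta> x)) \<otimes> x \<oplus> x [^] Suc n \<otimes> \<delta> x"
    using x der_mult[of "x [^] Suc n" x] Suc by simp
  also have "([Suc n] \<cdot> (x [^] n \<otimes> \<delta> x)) \<otimes> x = [Suc n] \<cdot> (x [^] Suc n \<otimes> \<delta> x)"
    using x by (subst add_pow_ldistr) (auto simp: m_ac)
  finally show ?case using x by simp
qed (use x in simp)

lemma multiple_eq_zeroD:
  assumes "y \<in> carrier K" "[(n::nat)] \<cdot> y = \<zero>" "[n] \<cdot> \<one> \<noteq> \<zero>"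
  shows "y = \<zero>"
proof -
  have "([n] \<cdot> \<one>) \<otimes> y = \<zero>" using assms by (simp add: add_pow_ldistr)
  then show ?thesis using assms integral by blast
qed

text \<open>
  A finite field with \<open>q\<close> elements satisfies \<open>x ^ q = x\<close> and \<open>q = 0\<close>, hence
  \<open>\<delta> x = q x ^ (q - 1) \<delta> x = 0\<close>. Both identities come from Lagrange's theorem, for the
  multiplicative and for the additive group.
\<close>

lemma der_vanishes_on_finite_subfield:
  assumes L: "subfield L K" and fin: "finite L" and x: "x \<in> L"
  shows "\<delta> x = \<zero>"
proof -
  interpret L: field "K\<lparr>carrier := L\<rparr>" using subfield_iff(2)[OF L] .
  have xK: "x \<in> carrier K" using subfieldE(3)[OF L] x by blast
  have LK: "L \<subseteq> carrier K" using subfieldE(3)[OF L] .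
  obtain m where m: "card L = Suc m"
    using fin x by (metis card_gt_0_iff emptyE gr0_implies_Suc)
  have pow: "y [^]\<^bsub>K\<lparr>carrier := L\<rparr>\<^esub> (n::nat) = y [^] n" for y n
    by (simp add: nat_pow_def)
  have "x [^] Suc m = x"
  proof (cases "x = \<zero>")
    case False
    have "x [^]\<^bsub>Multiplicative_Group.mult_of (K\<lparr>carrier := L\<rparr>)\<^esub> order (Multiplicative_Group.mult_of (K\<lparr>carrier := L\<rparr>)) = \<one>"
      using group.pow_order_eq_1[OF L.field_mult_group, of x] x False by simp
    moreover have "order (Multiplicative_Group.mult_of (K\<lparr>carrier := L\<rparr>)) = m"
      using m fin L.zero_closed by (simp add: order_def)
    ultimately have "x [^] m = \<one>" by (simp add: Multiplicative_Group.nat_pow_mult_of pow)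
    then show ?thesis using xK by simp
  qed (simp add: xK)
  moreover have "[Suc m] \<cdot> \<one> = \<zero>"
  proof -
    have "\<one> [^]\<^bsub>add_monoid (K\<lparr>carrier := L\<rparr>)\<^esub> order (add_monoid (K\<lparr>carrier := L\<rparr>)) = \<zero>"
      using group.pow_order_eq_1[OF L.add.group_axioms, of \<one>] L.one_closed by simp
    then show ?thesis using m by (simp add: order_def add_pow_def nat_pow_def)
  qed
  ultimately have "\<delta> x = [Suc m] \<cdot> (x [^] m \<otimes> \<delta> x)" using der_pow[OF xK, of m] by simp
  also have "\<dots> = ([Suc m] \<cdot> \<one>) \<otimes> (x [^] m \<otimes> \<delta> x)"
    using xK by (subst add_pow_ldistr) auto
  finally show ?thesis using \<open>[Suc m] \<cdot> \<one> = \<zero>\<close> xK by simp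
qed

text \<open>
  An element of the extension is a linear combination of the powers of \<open>x\<close> below the degree of \<open>x\<close>,
  and there are finitely many choices for the coefficients.
\<close>

lemma finite_simple_extension:
  assumes F: "subfield F K" and fin: "finite F" and x: "x \<in> carrier K" "(algebraic over F) x"
  shows "finite (simple_extension F x)"
proof -
  let ?B = "exp_base x (degree (Irr F x))"
  have B: "set ?B \<subseteq> carrier K" using x(1) by (auto simp: exp_base_def)
  have "simple_extension F x = {combine Ks ?B | Ks. length Ks = length ?B \<and> set Ks \<subseteq> F}"
    using Span_exp_base[OF F x] Span_eq_combine_set_length_version[OF F B] by simp
  also have "\<dots> = (\<lambda>Ks. combine Ks ?B) ` {Ks. set Ks \<subseteq> F \<and> length Ks = length ?B}" by auto
  finally show ?thesis using finite_lists_length_eq[OF fin] by simp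
qed

lemma der_vanishes_over_finite:
  assumes F: "subfield F K" and fin: "finite F" and x: "x \<in> carrier K" "(algebraic over F) x"
  shows "\<delta> x = \<zero>"
  using der_vanishes_on_finite_subfield[of "simple_extension F x"]
    simple_extension_is_subfield[OF F x(1)] finite_simple_extension[OF F fin x]
    simple_extension_mem[OF subfieldE(1)[OF F] x(1)] x(2) by blast

text \<open>Polynomials are lists with the leading coefficient first, as in \<open>eval\<close>.\<close>

fun formal_deriv :: "'a list \<Rightarrow> 'a list" where
  "formal_deriv [] = []"
| "formal_deriv [c] = []"
| "formal_deriv (c # d # p) = ([Suc (length p)] \<cdot> c) # formal_deriv (d # p)"

lemma length_formal_deriv: "length (formal_deriv p) = length p - 1"
  by (induct p rule: formal_deriv.induct) auto

lemma formal_deriv_closed: "set p \<subseteq> carrier K \<Longrightarrow> set (formal_deriv p) \<subseteq> carrier K"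
  by (induct p rule: formal_deriv.induct) auto

lemma der_eval:
  assumes "set p \<subseteq> carrier K" "\<forall>c\<in>set p. \<delta> c = \<zero>" "x \<in> carrier K"
  shows "\<delta> (eval p x) = eval (formal_deriv p) x \<otimes> \<delta> x"
  using assms
proof (induct p rule: formal_deriv.induct)
  case (3 c d p)
  let ?n = "length p"
  have c: "c \<in> carrier K" "\<delta> c = \<zero>" and x: "x \<in> carrier K" using 3 by auto
  have e: "eval (d # p) x \<in> carrier K" "eval (formal_deriv (d # p)) x \<in> carrier K"
    using 3 formal_deriv_closed[of "d # p"] by (auto intro!: eval_in_carrier simp del: eval.simps)
  \<comment> \<open>Here \<open>c\<close> is the coefficient of the power \<open>length p + 1\<close> of \<open>x\<close>.\<close>
  have "\<delta> (eval (c # d # p) x) = \<delta> (c \<otimes> x [^] Suc ?n) \<oplus> \<delta> (eval (d # p) x)"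
    using der_add[of "c \<otimes> x [^] Suc ?n" "eval (d # p) x"] c x e by simp
  also have "\<delta> (eval (d # p) x) = eval (formal_deriv (d # p)) x \<otimes> \<delta> x"
    using 3 by simp
  also have "\<delta> (c \<otimes> x [^] Suc ?n) = c \<otimes> ([Suc ?n] \<cdot> (x [^] ?n \<otimes> \<delta> x))"
    using der_mult[of c "x [^] Suc ?n"] der_pow[OF x, of ?n] c x
    by (simp del: nat_pow_Suc add.nat_pow_Suc)
  also have "\<dots> = ([Suc ?n] \<cdot> c) \<otimes> x [^] ?n \<otimes> \<delta> x"
    using c x by (simp add: add_pow_ldistr add_pow_rdistr m_assoc del: add.nat_pow_Suc)
  finally show ?case using c x e
    by (simp add: l_distr length_formal_deriv del: add.nat_pow_Suc)
qed auto

text \<open>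
  The chain rule \<open>0 = \<delta> (p x) = p' x * \<delta> x\<close> shows that \<open>\<delta> x = 0\<close> or that \<open>x\<close> is a root of
  \<open>p'\<close>, a polynomial of smaller degree which is not zero in characteristic 0.
\<close>

lemma der_vanishes_on_root:
  assumes char0: "\<And>n::nat. n > 0 \<Longrightarrow> [n] \<cdot> \<one> \<noteq> \<zero>"
    and "set p \<subseteq> carrier K" "\<forall>c\<in>set p. \<delta> c = \<zero>" "x \<in> carrier K"
    and "p \<noteq> []" "hd p \<noteq> \<zero>" "eval p x = \<zero>"
  shows "\<delta> x = \<zero>"
  using assms(2-)
proof (induct "length p" arbitrary: p rule: less_induct)
  case less
  consider c where "p = [c]" | c d q where "p = c # d # q"
    using less.prems(4) by (metis neq_Nil_conv)
  then show ?case
  proof cases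
    case 1
    then show ?thesis using less.prems by simp
  next
    case (2 c d q)
    have c: "c \<in> carrier K" "c \<noteq> \<zero>" using less.prems 2 by auto
    have lead: "hd (formal_deriv p) \<noteq> \<zero>"
      using 2 multiple_eq_zeroD[of c "Suc (length q)"] char0[of "Suc (length q)"] c
      by (auto simp del: add.nat_pow_Suc)
    have const: "\<forall>c\<in>set (formal_deriv p). \<delta> c = \<zero>"
      using less.prems(1,2)
      by (induct p rule: formal_deriv.induct) (auto simp: der_multiple simp del: add.nat_pow_Suc)
    have "eval (formal_deriv p) x \<otimes> \<delta> x = \<zero>"
      using der_eval[of p x] less.prems by simp
    moreover have "eval (formal_deriv p) x \<in> carrier K"
      using formal_deriv_closed less.prems by (auto intro: eval_in_carrier)
    ultimately have "eval (formal_deriv p) x = \<zero> \<or> \<delta> x = \<zero>"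
      using integral less.prems(3) by blast
    then show ?thesis
      using less.hyps[of "formal_deriv p"] formal_deriv_closed[OF less.prems(1)] const lead 2
        less.prems(3)
      by (auto simp: length_formal_deriv)
  qed
qed

text \<open>
  A rational number \<open>a\<close> satisfies \<open>m a + l = k\<close> with natural numbers \<open>m > 0\<close>, \<open>l\<close> and \<open>k\<close>, so that
  \<open>m \<delta> a = 0\<close>. Hence \<open>\<delta>\<close> vanishes on the prime field, and differentiating an algebraic equation
  over it is legitimate.
\<close>

lemma der_vanishes_over_rationals:
  assumes F: "subfield F K" and iso: "K\<lparr>carrier := F\<rparr> \<simeq> rat_ring"
    and x: "x \<in> carrier K" "(algebraic over F) x"
  shows "\<delta> x = \<zero>"
proof -
  obtain h where h: "h \<in> ring_iso (K\<lparr>carrier := F\<rparr>) rat_ring"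
    using iso by (auto simp: is_ring_iso_def)
  note FK = subringE[OF subfieldE(1)[OF F]]
  have h_add: "h (a \<oplus> b) = h a + h b" if "a \<in> F" "b \<in> F" for a b
    using ring_iso_memE(3)[OF h] that by (simp add: rat_ring_def)
  have h_one: "h \<one> = 1"
    using ring_iso_memE(4)[OF h] by (simp add: rat_ring_def)
  have h_inj: "inj_on h F"
    using ring_iso_memE(5)[OF h] by (simp add: bij_betw_def)
  have h_zero: "h \<zero> = 0" using h_add[of \<zero> \<zero>] FK(2) by simp
  have mult_F: "[(n::nat)] \<cdot> a \<in> F" if "a \<in> F" for n a
    by (induct n) (use that FK in auto)
  have h_mult: "h ([(n::nat)] \<cdot> a) = of_nat n * h a" if "a \<in> F" for n a
    by (induct n) (use that mult_F in \<open>auto simp: h_zero h_add algebra_simps\<close>)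
  have char0: "[n] \<cdot> \<one> \<noteq> \<zero>" if "n > 0" for n :: nat
    using h_mult[of \<one> n] FK(3) that h_one h_zero by auto
  have const: "\<delta> a = \<zero>" if a: "a \<in> F" for a
  proof -
    have aK: "a \<in> carrier K" using FK(1) a by blast
    obtain u v where uv: "h a = of_int u / of_int v" "v > 0"
      by (metis quotient_of_div quotient_of_denom_pos surj_pair)
    \<comment> \<open>The term \<open>l\<close> absorbs a negative numerator, which keeps all multiples natural.\<close>
    define m k l where "m = nat v" and "k = nat u" and "l = nat (- u)"
    have m: "m > 0" "of_nat m * h a + of_nat l = of_nat k"
      using uv by (auto simp: m_def k_def l_def)
    have "h ([m] \<cdot> a \<oplus> [l] \<cdot> \<one>) = h ([k] \<cdot> \<one>)"
      using m h_mult a FK(3) mult_F h_add h_one by simp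
    then have "[m] \<cdot> a \<oplus> [l] \<cdot> \<one> = [k] \<cdot> \<one>"
      using h_inj a FK(3,7) mult_F by (simp add: inj_on_def)
    then have "\<delta> ([m] \<cdot> a \<oplus> [l] \<cdot> \<one>) = \<delta> ([k] \<cdot> \<one>)" by simp
    then have "[m] \<cdot> \<delta> a = \<zero>" using aK by (simp add: der_add der_multiple)
    then show ?thesis using multiple_eq_zeroD char0 m(1) aK by blast
  qed
  obtain p where p: "p \<in> carrier (F[X])" "p \<noteq> []" "eval p x = \<zero>"
    using algebraicE[OF subfieldE(1)[OF F] x] .
  then have "set p \<subseteq> F" "hd p \<noteq> \<zero>"
    by (auto simp: univ_poly_def polynomial_def)
  then show ?thesis
    using der_vanishes_on_root[of p x] char0 const FK(1) x(1) p by blast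
qed

theorem der_vanishes:
  assumes "algebraic_over_prime_field K" "x \<in> carrier K"
  shows "\<delta> x = \<zero>"
proof -
  obtain F where F: "subfield F K" "prime_field (K\<lparr>carrier := F\<rparr>)" "(algebraic over F) x"
    using assms by (auto simp: algebraic_over_prime_field_def)
  then consider "K\<lparr>carrier := F\<rparr> \<simeq> rat_ring" | p :: nat where "K\<lparr>carrier := F\<rparr> \<simeq> residue_ring (int p)"
    by (auto simp: prime_field_def)
  then show ?thesis
  proof cases
    case 1
    then show ?thesis using der_vanishes_over_rationals F assms(2) by blast
  next
    case (2 p)
    then obtain h where "bij_betw h F {0..int p - 1}"
      by (auto simp: is_ring_iso_def ring_iso_def residue_ring_def)
    then have "finite F" using bij_betw_finite by blast
    then show ?thesis using der_vanishes_over_finite F assms(2) by blast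
  qed
qed

end

section \<open>Homomorphisms out of a presented group\<close>

lemma words_Nil [simp]: "[] \<in> words S"
  and words_Cons [simp]: "x # w \<in> words S \<longleftrightarrow> x \<in> letters S \<and> w \<in> words S"
  and words_append [simp]: "u @ v \<in> words S \<longleftrightarrow> u \<in> words S \<and> v \<in> words S"
  by (auto simp: words_def)

lemma letters_simps [simp]:
  "Gen s \<in> letters S \<longleftrightarrow> s \<in> S" "Inv s \<in> letters S \<longleftrightarrow> s \<in> S"
  by (auto simp: letters_def)

lemma inv_letter_letters [simp]: "inv_letter x \<in> letters S \<longleftrightarrow> x \<in> letters S"
  by (cases x) auto

lemma inv_letter_inv_letter [simp]: "inv_letter (inv_letter x) = x"
  by (cases x) auto

definition inv_word :: "'s letter list \<Rightarrow> 's letter list" where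
  "inv_word w = rev (map inv_letter w)"

lemma inv_word_words [simp]: "inv_word w \<in> words S \<longleftrightarrow> w \<in> words S"
  by (induct w) (auto simp: inv_word_def)

lemma inv_word_Cons: "inv_word (x # w) = inv_word w @ [inv_letter x]"
  by (simp add: inv_word_def)

lemma free_equiv_words: "(u, v) \<in> free_equiv S \<Longrightarrow> u \<in> words S \<and> v \<in> words S"
  by (induct rule: free_equiv.induct) auto

lemma equiv_free_equiv: "equiv (words S) (free_equiv S)"
  by (auto simp: equiv_def refl_on_def sym_def trans_def
      intro: free_equiv.intros dest: free_equiv_words)

lemma free_equiv_context:
  assumes "(u, v) \<in> free_equiv S" "a \<in> words S" "b \<in> words S"
  shows "(a @ u @ b, a @ v @ b) \<in> free_equiv S"
  using assms
proof (induct rule: free_equiv.induct)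
  case (cancel u v x)
  then show ?case using free_equiv.cancel[of "a @ u" S "v @ b" x] by simp
qed (auto intro: free_equiv.intros)

lemma free_equiv_append:
  assumes "(u, u') \<in> free_equiv S" "(v, v') \<in> free_equiv S"
  shows "(u @ v, u' @ v') \<in> free_equiv S"
  using free_equiv_context[OF assms(1), of "[]" v] free_equiv_context[OF assms(2), of u' "[]"]
    free_equiv_words[OF assms(1)] free_equiv_words[OF assms(2)]
  by (auto intro: free_equiv.trans)

text \<open>
  The last letter of the inverse word cancels against the first letter of \<open>w\<close>, which leaves the
  same product for a shorter word.
\<close>

lemma free_equiv_inverse:
  "w \<in> words S \<Longrightarrow> (inv_word w @ w, []) \<in> free_equiv S"
proof (induct w)
  case (Cons x w)
  have "(inv_word w @ [inv_letter x, inv_letter (inv_letter x)] @ w, inv_word w @ w) \<in> free_equiv S"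
    using Cons.prems by (intro free_equiv.cancel) auto
  then show ?case using Cons by (auto simp: inv_word_Cons intro: free_equiv.trans)
qed (auto simp: inv_word_def intro: free_equiv.refl)

lemma free_class_eq_iff:
  assumes "u \<in> words S" "v \<in> words S"
  shows "free_class S u = free_class S v \<longleftrightarrow> (u, v) \<in> free_equiv S"
  using eq_equiv_class_iff[OF equiv_free_equiv assms] by (simp add: free_class_def)

lemma free_group_carrier: "carrier (free_group S) = free_class S ` words S"
  by (auto simp: free_group_def quotient_def free_class_def)

lemma free_group_one: "\<one>\<^bsub>free_group S\<^esub> = free_class S []"
  by (simp add: free_group_def)

lemma free_group_mult:
  assumes "u \<in> words S" "v \<in> words S"
  shows "free_class S u \<otimes>\<^bsub>free_group S\<^esub> free_class S v = free_class S (u @ v)"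
proof -
  have "free_class S (a @ b) = free_class S (u @ v)" if "a \<in> free_class S u" "b \<in> free_class S v" for a b
  proof -
    have "(u @ v, a @ b) \<in> free_equiv S"
      using that by (auto simp: free_class_def intro: free_equiv_append)
    then show ?thesis using free_class_eq_iff free_equiv_words by blast
  qed
  moreover have "u \<in> free_class S u" "v \<in> free_class S v"
    using assms by (auto simp: free_class_def intro: free_equiv.refl)
  ultimately have "(\<Union>a\<in>free_class S u. \<Union>b\<in>free_class S v. free_class S (a @ b)) = free_class S (u @ v)"
    by blast
  then show ?thesis by (simp add: free_group_def)
qed

lemma group_free_group: "group (free_group S)"
proof (rule groupI)
  fix A assume "A \<in> carrier (free_group S)"
  then obtain w where w: "A = free_class S w" "w \<in> words S" by (auto simp: free_group_carrier)
  then have "free_class S (inv_word w) \<otimes>\<^bsub>free_group S\<^esub> A = \<one>\<^bsub>free_group S\<^esub>"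
    using free_equiv_inverse by (simp add: free_group_mult free_group_one free_class_eq_iff)
  then show "\<exists>B\<in>carrier (free_group S). B \<otimes>\<^bsub>free_group S\<^esub> A = \<one>\<^bsub>free_group S\<^esub>"
    using w by (auto simp: free_group_carrier)
qed (auto simp: free_group_carrier free_group_mult free_group_one)

subsection \<open>Evaluation of words\<close>

lemma word_val_Nil [simp]: "word_val G \<iota> [] = \<one>\<^bsub>G\<^esub>"
  and word_val_Cons [simp]: "word_val G \<iota> (x # w) = letter_val G \<iota> x \<otimes>\<^bsub>G\<^esub> word_val G \<iota> w"
  by (simp_all add: word_val_def list_mult_def)

locale word_evaluation = group G for G (structure) +
  fixes S :: "'s set" and \<iota>
  assumes gen_closed: "\<iota> \<in> S \<rightarrow> carrier G"
begin

lemma gen_mem [simp]: "s \<in> S \<Longrightarrow> \<iota> s \<in> carrier G"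
  using gen_closed by blast

lemma letter_val_closed [simp]: "x \<in> letters S \<Longrightarrow> letter_val G \<iota> x \<in> carrier G"
  by (cases x) auto

lemma word_val_closed [simp]: "w \<in> words S \<Longrightarrow> word_val G \<iota> w \<in> carrier G"
  by (induct w) auto

lemma word_val_append:
  "u \<in> words S \<Longrightarrow> v \<in> words S \<Longrightarrow> word_val G \<iota> (u @ v) = word_val G \<iota> u \<otimes> word_val G \<iota> v"
  by (induct u) (auto simp: m_assoc)

lemma letter_val_inv_letter:
  "x \<in> letters S \<Longrightarrow> letter_val G \<iota> (inv_letter x) = inv (letter_val G \<iota> x)"
  by (cases x) auto

lemma word_val_free_equiv:
  "(u, v) \<in> free_equiv S \<Longrightarrow> word_val G \<iota> u = word_val G \<iota> v"
proof (induct rule: free_equiv.induct)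
  case (cancel u v x)
  then have "word_val G \<iota> ([x, inv_letter x] @ v) = word_val G \<iota> v"
    by (simp add: letter_val_inv_letter m_assoc[symmetric])
  then show ?case using cancel word_val_append[of u "[x, inv_letter x] @ v"]
    by (simp add: word_val_append)
qed auto

lemma word_val_inv_word:
  assumes "w \<in> words S"
  shows "word_val G \<iota> (inv_word w) = inv (word_val G \<iota> w)"
  using word_val_free_equiv[OF free_equiv_inverse[OF assms]] assms
  by (intro inv_equality[symmetric]) (auto simp: word_val_append)

text \<open>
  The evaluation map on the free group. The choice of a representative is harmless because free
  reduction does not change the value of a word.
\<close>

definition class_val :: "'s letter list set \<Rightarrow> 'a" where
  "class_val A = word_val G \<iota> (SOME w. w \<in> A)"

lemma class_val_free_class:
  assumes "w \<in> words S"
  shows "class_val (free_class S w) = word_val G \<iota> w"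
proof -
  have "w \<in> free_class S w" using assms by (auto simp: free_class_def intro: free_equiv.refl)
  then have "(SOME w'. w' \<in> free_class S w) \<in> free_class S w" by (rule someI)
  then show ?thesis
    using word_val_free_equiv by (force simp: class_val_def free_class_def)
qed

lemma class_val_hom: "class_val \<in> hom (free_group S) G"
  by (rule homI)
     (auto simp: free_group_carrier free_group_mult class_val_free_class word_val_append)

lemma hom_word_val:
  assumes "group H" "\<theta> \<in> hom G H" "w \<in> words S"
  shows "\<theta> (word_val G \<iota> w) = word_val H (\<theta> \<circ> \<iota>) w"
proof -
  interpret \<theta>: group_hom G H \<theta>
    using assms by (auto simp: group_hom_def group_hom_axioms_def group_axioms)
  have letter: "\<theta> (letter_val G \<iota> x) = letter_val H (\<theta> \<circ> \<iota>) x" if "x \<in> letters S" for x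
    using that by (cases x) auto
  show ?thesis using assms(3) by (induct w) (auto simp: letter)
qed

end

lemma word_val_cong:
  assumes "\<And>s. s \<in> S \<Longrightarrow> h s = h' s" "w \<in> words S"
  shows "word_val H h w = word_val H h' w"
proof -
  have letter: "letter_val H h x = letter_val H h' x" if "x \<in> letters S" for x
    using that assms(1) by (cases x) auto
  show ?thesis using assms(2) by (induct w) (auto simp: letter)
qed

lemma normal_closure_superset: "R \<subseteq> normal_closure F R"
  unfolding normal_closure_def by blast

lemma normal_closure_least: "N \<lhd> F \<Longrightarrow> R \<subseteq> N \<Longrightarrow> normal_closure F R \<subseteq> N"
  unfolding normal_closure_def by blast

locale presented_group = group G for G (structure) +
  fixes S :: "'s set" and \<iota> and T
  assumes pres: "presentation G S \<iota> T"
begin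

lemma relators_words: "T \<subseteq> words S"
  using pres by (simp add: presentation_def)

text \<open>
  A homomorphism that sends each generator \<open>s\<close> to \<open>\<iota> s\<close> is the evaluation of words in \<open>G\<close>, so the kernel condition
  becomes a statement about the values of words.
\<close>

lemma presentation_hom:
  obtains \<phi> where "\<phi> \<in> hom (free_group S) G" "\<iota> \<in> S \<rightarrow> carrier G"
    "\<forall>w\<in>words S. \<phi> (free_class S w) = word_val G \<iota> w"
    "\<phi> ` carrier (free_group S) = carrier G"
    "kernel (free_group S) G \<phi> = normal_closure (free_group S) (free_class S ` T)"
proof -
  obtain \<phi> where \<phi>: "\<phi> \<in> hom (free_group S) G" "\<And>s. s \<in> S \<Longrightarrow> \<phi> (free_class S [Gen s]) = \<iota> s"
    "\<phi> ` carrier (free_group S) = carrier G"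
    "kernel (free_group S) G \<phi> = normal_closure (free_group S) (free_class S ` T)"
    using pres unfolding presentation_def by blast
  interpret \<phi>: group_hom "free_group S" G \<phi>
    using \<phi>(1) by (auto simp: group_hom_def group_hom_axioms_def group_axioms group_free_group)
  have gen: "free_class S [Gen s] \<in> carrier (free_group S)" if "s \<in> S" for s
    using that by (auto simp: free_group_carrier)
  then have \<iota>: "\<iota> \<in> S \<rightarrow> carrier G" using \<phi>(2) \<phi>.hom_closed by fastforce
  then interpret word_evaluation G S \<iota> by unfold_locales
  have Inv: "free_class S [Inv s] = inv\<^bsub>free_group S\<^esub> free_class S [Gen s]" if "s \<in> S" for s
  proof -
    have "free_class S [Inv s] \<otimes>\<^bsub>free_group S\<^esub> free_class S [Gen s] = \<one>\<^bsub>free_group S\<^esub>"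
      using that free_equiv_inverse[of "[Gen s]" S]
      by (simp add: free_group_mult free_group_one free_class_eq_iff inv_word_def)
    then show ?thesis using that by (intro \<phi>.inv_equality[symmetric]) (auto simp: free_group_carrier)
  qed
  have letter: "\<phi> (free_class S [x]) = letter_val G \<iota> x" if "x \<in> letters S" for x
    using that \<phi>(2) gen Inv by (cases x) auto
  have "\<phi> (free_class S w) = word_val G \<iota> w" if "w \<in> words S" for w
    using that
  proof (induct w)
    case Nil
    then show ?case using \<phi>.hom_one by (simp add: free_group_one)
  next
    case (Cons x w)
    have "free_class S (x # w) = free_class S [x] \<otimes>\<^bsub>free_group S\<^esub> free_class S w"
      using Cons.prems by (simp add: free_group_mult)
    moreover have "free_class S [x] \<in> carrier (free_group S)" "free_class S w \<in> carrier (free_group S)"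
      using Cons.prems by (simp_all add: free_group_carrier)
    ultimately show ?case using Cons letter by simp
  qed
  then have "\<forall>w\<in>words S. \<phi> (free_class S w) = word_val G \<iota> w" by blast
  then show ?thesis by (rule that[OF \<phi>(1) \<iota> _ \<phi>(3,4)])
qed

lemma generators_closed: "\<iota> \<in> S \<rightarrow> carrier G"
  by (rule presentation_hom)

sublocale word_evaluation G S \<iota>
  by unfold_locales (rule generators_closed)

lemma generated:
  assumes "g \<in> carrier G"
  obtains w where "w \<in> words S" "word_val G \<iota> w = g"
proof -
  obtain \<phi> where \<phi>: "\<phi> \<in> hom (free_group S) G" "\<iota> \<in> S \<rightarrow> carrier G"
    "\<forall>w\<in>words S. \<phi> (free_class S w) = word_val G \<iota> w"
    "\<phi> ` carrier (free_group S) = carrier G"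
    "kernel (free_group S) G \<phi> = normal_closure (free_group S) (free_class S ` T)"
    using presentation_hom .
  have "g \<in> \<phi> ` carrier (free_group S)" using assms \<phi>(4) by simp
  then obtain w where "w \<in> words S" "g = \<phi> (free_class S w)"
    unfolding free_group_carrier by blast
  then have "w \<in> words S" "word_val G \<iota> w = g" using \<phi>(3) by simp_all
  then show ?thesis by (rule that)
qed

lemma relator_val:
  assumes "t \<in> T"
  shows "word_val G \<iota> t = \<one>"
proof -
  obtain \<phi> where \<phi>: "\<phi> \<in> hom (free_group S) G" "\<iota> \<in> S \<rightarrow> carrier G"
    "\<forall>w\<in>words S. \<phi> (free_class S w) = word_val G \<iota> w"
    "\<phi> ` carrier (free_group S) = carrier G"
    "kernel (free_group S) G \<phi> = normal_closure (free_group S) (free_class S ` T)"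
    using presentation_hom .
  have "free_class S t \<in> kernel (free_group S) G \<phi>"
    unfolding \<phi>(5) by (rule subsetD[OF normal_closure_superset imageI]) (rule assms)
  then show ?thesis using \<phi>(3)[rule_format, of t] assms relators_words by (simp add: kernel_def subset_iff)
qed

text \<open>
  Two words with the same value in \<open>G\<close> differ by an element of the normal closure of the
  relators. The kernel of the evaluation in \<open>H\<close> is a normal subgroup that contains the relators,
  hence it contains that normal closure.
\<close>

lemma same_word_val:
  assumes H: "word_evaluation H S h" and T: "\<And>t. t \<in> T \<Longrightarrow> word_val H h t = \<one>\<^bsub>H\<^esub>"
    and uv: "u \<in> words S" "v \<in> words S" "word_val G \<iota> u = word_val G \<iota> v"
  shows "word_val H h u = word_val H h v"
proof -
  interpret H: word_evaluation H S h by (rule H)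
  obtain \<phi> where \<phi>: "\<phi> \<in> hom (free_group S) G" "\<iota> \<in> S \<rightarrow> carrier G"
    "\<forall>w\<in>words S. \<phi> (free_class S w) = word_val G \<iota> w"
    "\<phi> ` carrier (free_group S) = carrier G"
    "kernel (free_group S) G \<phi> = normal_closure (free_group S) (free_class S ` T)"
    using presentation_hom .
  interpret \<psi>: group_hom "free_group S" H H.class_val
    using H.class_val_hom
    by (auto simp: group_hom_def group_hom_axioms_def H.group_axioms group_free_group)
  let ?w = "inv_word v @ u"
  have "free_class S ?w \<in> kernel (free_group S) G \<phi>"
  proof -
    have "word_val G \<iota> ?w = \<one>" using uv by (simp add: word_val_append word_val_inv_word)
    then show ?thesis using uv(1,2) \<phi>(3)[rule_format, of ?w] by (auto simp: kernel_def free_group_carrier)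
  qed
  moreover have "normal_closure (free_group S) (free_class S ` T) \<subseteq> kernel (free_group S) H H.class_val"
  proof -
    have "free_class S ` T \<subseteq> kernel (free_group S) H H.class_val"
      using T relators_words
      by (fastforce simp: kernel_def free_group_carrier H.class_val_free_class)
    then show ?thesis by (rule normal_closure_least[OF \<psi>.normal_kernel])
  qed
  ultimately have "free_class S ?w \<in> kernel (free_group S) H H.class_val"
    using \<phi>(5) by blast
  then have "word_val H h ?w = \<one>\<^bsub>H\<^esub>"
    using uv(1,2) by (simp add: kernel_def H.class_val_free_class)
  then have "inv\<^bsub>H\<^esub> word_val H h v \<otimes>\<^bsub>H\<^esub> word_val H h u = \<one>\<^bsub>H\<^esub>"
    using uv(1,2) by (simp add: H.word_val_append H.word_val_inv_word)
  then show ?thesis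
    using uv(1,2) H.inv_solve_left'[of "\<one>\<^bsub>H\<^esub>" "word_val H h v" "word_val H h u"] by simp
qed

text \<open>
  The universal property of a presentation: any assignment of the generators that kills the
  relators extends. The value at \<open>g\<close> is read off from an arbitrary word for \<open>g\<close>.
\<close>

theorem hom_from_presentation:
  assumes H: "word_evaluation H S h" and T: "\<And>t. t \<in> T \<Longrightarrow> word_val H h t = \<one>\<^bsub>H\<^esub>"
  obtains \<theta> where "\<theta> \<in> hom G H" "\<forall>w\<in>words S. \<theta> (word_val G \<iota> w) = word_val H h w"
proof -
  interpret H: word_evaluation H S h by (rule H)
  define \<theta> where "\<theta> g = word_val H h (SOME w. w \<in> words S \<and> word_val G \<iota> w = g)" for g
  have \<theta>: "\<theta> (word_val G \<iota> w) = word_val H h w" if "w \<in> words S" for w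
  proof -
    let ?w = "SOME w'. w' \<in> words S \<and> word_val G \<iota> w' = word_val G \<iota> w"
    have "?w \<in> words S \<and> word_val G \<iota> ?w = word_val G \<iota> w"
      by (rule someI[of _ w]) (use that in simp)
    then have "word_val H h ?w = word_val H h w"
      using same_word_val[OF H T] that by blast
    then show ?thesis by (simp add: \<theta>_def)
  qed
  have "\<theta> \<in> hom G H"
  proof (rule homI)
    fix x y assume xy: "x \<in> carrier G" "y \<in> carrier G"
    obtain u where u: "u \<in> words S" "word_val G \<iota> u = x" using generated[OF xy(1)] .
    obtain v where v: "v \<in> words S" "word_val G \<iota> v = y" using generated[OF xy(2)] .
    have val: "\<theta> x = word_val H h u" "\<theta> y = word_val H h v"
      using \<theta>[OF u(1)] \<theta>[OF v(1)] u(2) v(2) by simp_all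
    then show "\<theta> x \<in> carrier H" using u by simp
    have "word_val G \<iota> (u @ v) = x \<otimes> y" using u v word_val_append by simp
    moreover have "\<theta> (word_val G \<iota> (u @ v)) = word_val H h (u @ v)" using u v \<theta> by simp
    ultimately show "\<theta> (x \<otimes> y) = \<theta> x \<otimes>\<^bsub>H\<^esub> \<theta> y"
      using u v H.word_val_append val by simp
  qed
  moreover have "\<forall>w\<in>words S. \<theta> (word_val G \<iota> w) = word_val H h w" using \<theta> by blast
  ultimately show ?thesis by (rule that)
qed

end

section \<open>The twisted group ring\<close>

locale twisted_group_algebra = field K + G: group G
  for K :: "('k, 'n) ring_scheme" (structure) and G :: "('g, 'm) monoid_scheme" +
  fixes \<alpha> :: "'g \<Rightarrow> 'g \<Rightarrow> 'k"
  assumes cocycle: "normalized_cocycle K G \<alpha>"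
begin

abbreviation A where "A \<equiv> twisted_group_ring K G \<alpha>"
abbreviation bar where "bar \<equiv> tbasis K G"

lemma \<alpha>_Units: "x \<in> carrier G \<Longrightarrow> y \<in> carrier G \<Longrightarrow> \<alpha> x y \<in> Units K"
  using cocycle by (simp add: normalized_cocycle_def)

lemma \<alpha>_closed [simp]: "x \<in> carrier G \<Longrightarrow> y \<in> carrier G \<Longrightarrow> \<alpha> x y \<in> carrier K"
  using \<alpha>_Units Units_closed by blast

lemma \<alpha>_cocycle:
  "x \<in> carrier G \<Longrightarrow> y \<in> carrier G \<Longrightarrow> z \<in> carrier G \<Longrightarrow>
    \<alpha> x y \<otimes> \<alpha> (x \<otimes>\<^bsub>G\<^esub> y) z = \<alpha> y z \<otimes> \<alpha> x (y \<otimes>\<^bsub>G\<^esub> z)"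
  using cocycle by (simp add: normalized_cocycle_def)

lemma \<alpha>_one [simp]:
  "g \<in> carrier G \<Longrightarrow> \<alpha> \<one>\<^bsub>G\<^esub> g = \<one>" "g \<in> carrier G \<Longrightarrow> \<alpha> g \<one>\<^bsub>G\<^esub> = \<one>"
  using cocycle by (simp_all add: normalized_cocycle_def)

lemma A_coeff_closed [simp]: "a \<in> carrier A \<Longrightarrow> g \<in> carrier G \<Longrightarrow> a g \<in> carrier K"
  by (auto simp: twisted_group_ring_def)

lemma finite_supp: "a \<in> carrier A \<Longrightarrow> finite (supp K G a)"
  by (simp add: twisted_group_ring_def)

lemma supp_carrier: "supp K G a \<subseteq> carrier G"
  by (auto simp: supp_def)

lemma A_ext:
  assumes "a \<in> carrier A" "b \<in> carrier A" "\<And>x. x \<in> carrier G \<Longrightarrow> a x = b x"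
  shows "a = b"
  using assms by (auto simp: twisted_group_ring_def intro: PiE_ext)

text \<open>
  Membership of a coefficient function is certified by any finite superset of its support.
\<close>

lemma A_memI:
  assumes "finite F" "\<And>x. x \<in> carrier G \<Longrightarrow> u x \<in> carrier K"
    and "\<And>x. x \<in> carrier G \<Longrightarrow> x \<notin> F \<Longrightarrow> u x = \<zero>"
  shows "(\<lambda>x\<in>carrier G. u x) \<in> carrier A"
proof -
  have "supp K G (\<lambda>x\<in>carrier G. u x) \<subseteq> F" using assms(3) by (auto simp: supp_def)
  then show ?thesis using assms(1,2) finite_subset by (auto simp: twisted_group_ring_def)
qed

lemma add_A_apply [simp]: "x \<in> carrier G \<Longrightarrow> (a \<oplus>\<^bsub>A\<^esub> b) x = a x \<oplus> b x"
  and zero_A_apply [simp]: "x \<in> carrier G \<Longrightarrow> \<zero>\<^bsub>A\<^esub> x = \<zero>"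
  and smult_A_apply [simp]: "x \<in> carrier G \<Longrightarrow> (c \<odot>\<^bsub>A\<^esub> a) x = c \<otimes> a x"
  and bar_apply: "x \<in> carrier G \<Longrightarrow> bar g x = (if x = g then \<one> else \<zero>)"
  by (simp_all add: twisted_group_ring_def tbasis_def)

lemma one_A: "\<one>\<^bsub>A\<^esub> = bar \<one>\<^bsub>G\<^esub>"
  by (simp add: twisted_group_ring_def)

lemma bar_closed [simp]: "bar g \<in> carrier A"
  unfolding tbasis_def by (rule A_memI[of "{g}"]) auto

lemma zero_A_closed: "\<zero>\<^bsub>A\<^esub> \<in> carrier A"
  using A_memI[of "{}" "\<lambda>x. \<zero>"] by (simp add: twisted_group_ring_def)

lemma add_A_closed:
  assumes "a \<in> carrier A" "b \<in> carrier A"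
  shows "a \<oplus>\<^bsub>A\<^esub> b \<in> carrier A"
proof -
  have "(\<lambda>x\<in>carrier G. a x \<oplus> b x) \<in> carrier A"
    using assms finite_supp by (intro A_memI[of "supp K G a \<union> supp K G b"]) (auto simp: supp_def)
  then show ?thesis by (simp add: twisted_group_ring_def)
qed

lemma smult_A_closed:
  assumes "c \<in> carrier K" "a \<in> carrier A"
  shows "c \<odot>\<^bsub>A\<^esub> a \<in> carrier A"
proof -
  have "(\<lambda>x\<in>carrier G. c \<otimes> a x) \<in> carrier A"
    using assms finite_supp by (intro A_memI[of "supp K G a"]) (auto simp: supp_def)
  then show ?thesis by (simp add: twisted_group_ring_def)
qed

lemma mult_A_closed:
  assumes ab: "a \<in> carrier A" "b \<in> carrier A"
  shows "a \<otimes>\<^bsub>A\<^esub> b \<in> carrier A"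
proof -
  let ?P = "\<lambda>x. {(g, h). g \<in> supp K G a \<and> h \<in> supp K G b \<and> g \<otimes>\<^bsub>G\<^esub> h = x}"
  let ?u = "\<lambda>x. \<Oplus>p\<in>?P x. a (fst p) \<otimes> b (snd p) \<otimes> \<alpha> (fst p) (snd p)"
  have "(\<lambda>x\<in>carrier G. ?u x) \<in> carrier A"
  proof (rule A_memI)
    show "finite ((\<lambda>(g, h). g \<otimes>\<^bsub>G\<^esub> h) ` (supp K G a \<times> supp K G b))"
      using ab finite_supp by simp
    show "?u x \<in> carrier K" for x
      using ab supp_carrier by (intro finsum_closed) (auto simp: supp_def)
    show "?u x = \<zero>" if "x \<notin> (\<lambda>(g, h). g \<otimes>\<^bsub>G\<^esub> h) ` (supp K G a \<times> supp K G b)" for x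
    proof -
      have "?P x = {}" using that by force
      then show ?thesis by (simp only: finsum_empty)
    qed
  qed
  then show ?thesis by (simp add: twisted_group_ring_def)
qed

text \<open>
  The second factor of a product \<open>g h = x\<close> is determined by the first one, so the product is a
  single sum. As the sum may run over any finite set that contains the support of \<open>a\<close>,
  two products with different left factors can be compared term by term.
\<close>

lemma mult_A_apply:
  assumes ab: "a \<in> carrier A" "b \<in> carrier A" and x: "x \<in> carrier G"
    and F: "finite F" "supp K G a \<subseteq> F" "F \<subseteq> carrier G"
  shows "(a \<otimes>\<^bsub>A\<^esub> b) x =
    (\<Oplus>g\<in>F. a g \<otimes> b (inv\<^bsub>G\<^esub> g \<otimes>\<^bsub>G\<^esub> x) \<otimes> \<alpha> g (inv\<^bsub>G\<^esub> g \<otimes>\<^bsub>G\<^esub> x))"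
proof -
  let ?P = "{(g, h). g \<in> supp K G a \<and> h \<in> supp K G b \<and> g \<otimes>\<^bsub>G\<^esub> h = x}"
  let ?Y = "{g \<in> supp K G a. inv\<^bsub>G\<^esub> g \<otimes>\<^bsub>G\<^esub> x \<in> supp K G b}"
  let ?r = "\<lambda>g. (g, inv\<^bsub>G\<^esub> g \<otimes>\<^bsub>G\<^esub> x)"
  let ?t = "\<lambda>p. a (fst p) \<otimes> b (snd p) \<otimes> \<alpha> (fst p) (snd p)"
  have P: "?P = ?r ` ?Y"
  proof (intro equalityI subsetI)
    fix p assume "p \<in> ?P"
    then obtain g h where p: "p = (g, h)" "g \<in> supp K G a" "h \<in> supp K G b" "g \<otimes>\<^bsub>G\<^esub> h = x" by auto
    then have "g \<in> carrier G" "h \<in> carrier G" using supp_carrier by blast+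
    then have "h = inv\<^bsub>G\<^esub> g \<otimes>\<^bsub>G\<^esub> x" using p(4)[symmetric] by (simp add: G.m_assoc[symmetric])
    then show "p \<in> ?r ` ?Y" using p by auto
  next
    fix p assume "p \<in> ?r ` ?Y"
    then obtain g where "p = ?r g" "g \<in> ?Y" by auto
    moreover from this have "g \<in> carrier G" using supp_carrier by blast
    ultimately show "p \<in> ?P" using x by (simp add: G.m_assoc[symmetric])
  qed
  have "(a \<otimes>\<^bsub>A\<^esub> b) x = (\<Oplus>p\<in>?P. ?t p)"
    using x by (simp add: twisted_group_ring_def)
  also have "\<dots> = (\<Oplus>g\<in>?Y. ?t (?r g))"
    unfolding P using ab x supp_carrier
    by (intro finsum_reindex) (auto simp: inj_on_def supp_def)
  also have "\<dots> = (\<Oplus>g\<in>F. a g \<otimes> b (inv\<^bsub>G\<^esub> g \<otimes>\<^bsub>G\<^esub> x) \<otimes> \<alpha> g (inv\<^bsub>G\<^esub> g \<otimes>\<^bsub>G\<^esub> x))"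
  proof (rule add.finprod_mono_neutral_cong_left)
    show "a g \<otimes> b (inv\<^bsub>G\<^esub> g \<otimes>\<^bsub>G\<^esub> x) \<otimes> \<alpha> g (inv\<^bsub>G\<^esub> g \<otimes>\<^bsub>G\<^esub> x) = \<zero>" if "g \<in> F - ?Y" for g
    proof -
      have g: "g \<in> carrier G" "inv\<^bsub>G\<^esub> g \<otimes>\<^bsub>G\<^esub> x \<in> carrier G" using that F(3) x by auto
      then have "a g = \<zero> \<or> b (inv\<^bsub>G\<^esub> g \<otimes>\<^bsub>G\<^esub> x) = \<zero>" using that by (auto simp: supp_def)
      then show ?thesis using ab g by auto
    qed
  qed (use F ab x in \<open>auto simp: Pi_def subset_iff\<close>)
  finally show ?thesis .
qed

lemma abelian_group_A: "abelian_group A"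
proof (rule abelian_groupI)
  fix a assume a: "a \<in> carrier A"
  then have "(\<lambda>x\<in>carrier G. \<ominus> a x) \<in> carrier A"
    using finite_supp by (intro A_memI[of "supp K G a"]) (auto simp: supp_def)
  moreover from this have "(\<lambda>x\<in>carrier G. \<ominus> a x) \<oplus>\<^bsub>A\<^esub> a = \<zero>\<^bsub>A\<^esub>"
    using a by (intro A_ext) (auto simp: add_A_closed zero_A_closed l_neg)
  ultimately show "\<exists>b\<in>carrier A. b \<oplus>\<^bsub>A\<^esub> a = \<zero>\<^bsub>A\<^esub>" by blast
qed (auto intro!: A_ext simp: add_A_closed zero_A_closed a_assoc, simp add: a_comm)

sublocale A: module K A
  by (rule moduleI)
     (auto intro!: A_ext is_cring abelian_group_A
       simp: smult_A_closed add_A_closed l_distr r_distr m_assoc)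

lemma A_distr_l:
  assumes "a \<in> carrier A" "b \<in> carrier A" "c \<in> carrier A"
  shows "(a \<oplus>\<^bsub>A\<^esub> b) \<otimes>\<^bsub>A\<^esub> c = a \<otimes>\<^bsub>A\<^esub> c \<oplus>\<^bsub>A\<^esub> b \<otimes>\<^bsub>A\<^esub> c"
proof (rule A_ext)
  fix x assume x: "x \<in> carrier G"
  define F where "F = supp K G a \<union> supp K G b \<union> supp K G (a \<oplus>\<^bsub>A\<^esub> b)"
  have F: "finite F" "F \<subseteq> carrier G" "supp K G a \<subseteq> F" "supp K G b \<subseteq> F" "supp K G (a \<oplus>\<^bsub>A\<^esub> b) \<subseteq> F"
    using assms finite_supp supp_carrier by (auto simp: F_def)
  let ?t = "\<lambda>a g. a g \<otimes> c (inv\<^bsub>G\<^esub> g \<otimes>\<^bsub>G\<^esub> x) \<otimes> \<alpha> g (inv\<^bsub>G\<^esub> g \<otimes>\<^bsub>G\<^esub> x)"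
  have t: "?t a g \<in> carrier K" "?t b g \<in> carrier K" "?t (a \<oplus>\<^bsub>A\<^esub> b) g = ?t a g \<oplus> ?t b g" if "g \<in> F" for g
    using that F(2) assms x by (auto simp: l_distr)
  have "((a \<oplus>\<^bsub>A\<^esub> b) \<otimes>\<^bsub>A\<^esub> c) x = (\<Oplus>g\<in>F. ?t (a \<oplus>\<^bsub>A\<^esub> b) g)"
    using mult_A_apply[OF _ _ x F(1) F(5,2)] assms by simp
  also have "\<dots> = (\<Oplus>g\<in>F. ?t a g \<oplus> ?t b g)"
    using t by (intro finsum_cong') auto
  also have "\<dots> = (\<Oplus>g\<in>F. ?t a g) \<oplus> (\<Oplus>g\<in>F. ?t b g)"
    using t by (intro finsum_addf) auto
  also have "\<dots> = (a \<otimes>\<^bsub>A\<^esub> c \<oplus>\<^bsub>A\<^esub> b \<otimes>\<^bsub>A\<^esub> c) x"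
    using mult_A_apply[OF _ _ x F(1) F(3,2)] mult_A_apply[OF _ _ x F(1) F(4,2)] assms x by simp
  finally show "((a \<oplus>\<^bsub>A\<^esub> b) \<otimes>\<^bsub>A\<^esub> c) x = (a \<otimes>\<^bsub>A\<^esub> c \<oplus>\<^bsub>A\<^esub> b \<otimes>\<^bsub>A\<^esub> c) x" .
qed (use assms mult_A_closed in auto)

lemma A_distr_r:
  assumes "a \<in> carrier A" "b \<in> carrier A" "c \<in> carrier A"
  shows "c \<otimes>\<^bsub>A\<^esub> (a \<oplus>\<^bsub>A\<^esub> b) = c \<otimes>\<^bsub>A\<^esub> a \<oplus>\<^bsub>A\<^esub> c \<otimes>\<^bsub>A\<^esub> b"
proof (rule A_ext)
  fix x assume x: "x \<in> carrier G"
  let ?F = "supp K G c"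
  let ?t = "\<lambda>a g. c g \<otimes> a (inv\<^bsub>G\<^esub> g \<otimes>\<^bsub>G\<^esub> x) \<otimes> \<alpha> g (inv\<^bsub>G\<^esub> g \<otimes>\<^bsub>G\<^esub> x)"
  note mult = mult_A_apply[OF assms(3) _ x finite_supp[OF assms(3)] order_refl supp_carrier]
  have t: "?t a g \<in> carrier K" "?t b g \<in> carrier K" "?t (a \<oplus>\<^bsub>A\<^esub> b) g = ?t a g \<oplus> ?t b g" if "g \<in> ?F" for g
    using subsetD[OF supp_carrier that] assms x by (auto simp: l_distr r_distr)
  have "(c \<otimes>\<^bsub>A\<^esub> (a \<oplus>\<^bsub>A\<^esub> b)) x = (\<Oplus>g\<in>?F. ?t (a \<oplus>\<^bsub>A\<^esub> b) g)"
    using mult assms by simp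
  also have "\<dots> = (\<Oplus>g\<in>?F. ?t a g \<oplus> ?t b g)"
    using t by (intro finsum_cong') auto
  also have "\<dots> = (\<Oplus>g\<in>?F. ?t a g) \<oplus> (\<Oplus>g\<in>?F. ?t b g)"
    using t by (intro finsum_addf) auto
  also have "\<dots> = (c \<otimes>\<^bsub>A\<^esub> a \<oplus>\<^bsub>A\<^esub> c \<otimes>\<^bsub>A\<^esub> b) x"
    using mult assms x by simp
  finally show "(c \<otimes>\<^bsub>A\<^esub> (a \<oplus>\<^bsub>A\<^esub> b)) x = (c \<otimes>\<^bsub>A\<^esub> a \<oplus>\<^bsub>A\<^esub> c \<otimes>\<^bsub>A\<^esub> b) x" .
qed (use assms mult_A_closed in auto)

lemma A_smult_l:
  assumes "k \<in> carrier K" "a \<in> carrier A" "b \<in> carrier A"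
  shows "(k \<odot>\<^bsub>A\<^esub> a) \<otimes>\<^bsub>A\<^esub> b = k \<odot>\<^bsub>A\<^esub> (a \<otimes>\<^bsub>A\<^esub> b)"
proof (rule A_ext)
  fix x assume x: "x \<in> carrier G"
  let ?F = "supp K G a"
  let ?t = "\<lambda>a g. a g \<otimes> b (inv\<^bsub>G\<^esub> g \<otimes>\<^bsub>G\<^esub> x) \<otimes> \<alpha> g (inv\<^bsub>G\<^esub> g \<otimes>\<^bsub>G\<^esub> x)"
  have F: "supp K G (k \<odot>\<^bsub>A\<^esub> a) \<subseteq> ?F" using assms(1) by (auto simp: supp_def)
  have t: "?t a g \<in> carrier K" "?t (k \<odot>\<^bsub>A\<^esub> a) g = k \<otimes> ?t a g" if "g \<in> ?F" for g
    using subsetD[OF supp_carrier that] assms x by (auto simp: m_assoc)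
  have "((k \<odot>\<^bsub>A\<^esub> a) \<otimes>\<^bsub>A\<^esub> b) x = (\<Oplus>g\<in>?F. ?t (k \<odot>\<^bsub>A\<^esub> a) g)"
    using mult_A_apply[OF _ _ x finite_supp[OF assms(2)] F supp_carrier] assms by simp
  also have "\<dots> = (\<Oplus>g\<in>?F. k \<otimes> ?t a g)"
    using t assms(1) by (intro finsum_cong') auto
  also have "\<dots> = k \<otimes> (\<Oplus>g\<in>?F. ?t a g)"
    using t assms(1) finite_supp[OF assms(2)] by (intro finsum_rdistr[symmetric]) auto
  also have "\<dots> = (k \<odot>\<^bsub>A\<^esub> (a \<otimes>\<^bsub>A\<^esub> b)) x"
    using mult_A_apply[OF assms(2,3) x finite_supp[OF assms(2)] order_refl supp_carrier] x by simp
  finally show "((k \<odot>\<^bsub>A\<^esub> a) \<otimes>\<^bsub>A\<^esub> b) x = (k \<odot>\<^bsub>A\<^esub> (a \<otimes>\<^bsub>A\<^esub> b)) x" .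
qed (use assms mult_A_closed in auto)

lemma A_smult_r:
  assumes "k \<in> carrier K" "a \<in> carrier A" "b \<in> carrier A"
  shows "a \<otimes>\<^bsub>A\<^esub> (k \<odot>\<^bsub>A\<^esub> b) = k \<odot>\<^bsub>A\<^esub> (a \<otimes>\<^bsub>A\<^esub> b)"
proof (rule A_ext)
  fix x assume x: "x \<in> carrier G"
  let ?F = "supp K G a"
  let ?t = "\<lambda>b g. a g \<otimes> b (inv\<^bsub>G\<^esub> g \<otimes>\<^bsub>G\<^esub> x) \<otimes> \<alpha> g (inv\<^bsub>G\<^esub> g \<otimes>\<^bsub>G\<^esub> x)"
  note mult = mult_A_apply[OF assms(2) _ x finite_supp[OF assms(2)] order_refl supp_carrier]
  have t: "?t b g \<in> carrier K" "?t (k \<odot>\<^bsub>A\<^esub> b) g = k \<otimes> ?t b g" if "g \<in> ?F" for g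
    using subsetD[OF supp_carrier that] assms x by (auto simp: m_ac)
  have "(a \<otimes>\<^bsub>A\<^esub> (k \<odot>\<^bsub>A\<^esub> b)) x = (\<Oplus>g\<in>?F. ?t (k \<odot>\<^bsub>A\<^esub> b) g)"
    using mult assms by simp
  also have "\<dots> = (\<Oplus>g\<in>?F. k \<otimes> ?t b g)"
    using t assms(1) by (intro finsum_cong') auto
  also have "\<dots> = k \<otimes> (\<Oplus>g\<in>?F. ?t b g)"
    using t assms(1) finite_supp[OF assms(2)] by (intro finsum_rdistr[symmetric]) auto
  also have "\<dots> = (k \<odot>\<^bsub>A\<^esub> (a \<otimes>\<^bsub>A\<^esub> b)) x"
    using mult assms x by simp
  finally show "(a \<otimes>\<^bsub>A\<^esub> (k \<odot>\<^bsub>A\<^esub> b)) x = (k \<odot>\<^bsub>A\<^esub> (a \<otimes>\<^bsub>A\<^esub> b)) x" .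
qed (use assms mult_A_closed in auto)

lemma supp_bar: "g \<in> carrier G \<Longrightarrow> supp K G (bar g) = {g}"
  by (auto simp: supp_def bar_apply split: if_splits)

lemma bar_mult:
  assumes g: "g \<in> carrier G" and h: "h \<in> carrier G"
  shows "bar g \<otimes>\<^bsub>A\<^esub> bar h = \<alpha> g h \<odot>\<^bsub>A\<^esub> bar (g \<otimes>\<^bsub>G\<^esub> h)"
proof (rule A_ext)
  fix x assume x: "x \<in> carrier G"
  have "inv\<^bsub>G\<^esub> g \<otimes>\<^bsub>G\<^esub> x = h \<longleftrightarrow> x = g \<otimes>\<^bsub>G\<^esub> h"
    using g h x by (simp add: G.inv_solve_left')
  then show "(bar g \<otimes>\<^bsub>A\<^esub> bar h) x = (\<alpha> g h \<odot>\<^bsub>A\<^esub> bar (g \<otimes>\<^bsub>G\<^esub> h)) x"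
    using g h x by (auto simp: mult_A_apply[of "bar g" _ x "{g}"] supp_bar bar_apply)
qed (use assms mult_A_closed in auto)

lemma one_A_mult:
  assumes "a \<in> carrier A"
  shows "\<one>\<^bsub>A\<^esub> \<otimes>\<^bsub>A\<^esub> a = a"
proof (rule A_ext)
  fix x assume x: "x \<in> carrier G"
  then show "(\<one>\<^bsub>A\<^esub> \<otimes>\<^bsub>A\<^esub> a) x = a x"
    using assms by (simp add: one_A mult_A_apply[of _ a x "{\<one>\<^bsub>G\<^esub>}"] supp_bar bar_apply)
qed (use assms mult_A_closed one_A in auto)

text \<open>
  The elements are finitely supported, so the scalar multiples of basis elements span. This rule
  reduces multilinear identities, such as associativity and the Leibniz rule, to the basis.
\<close>

lemma A_induct [consumes 1, case_names zero basis add]: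
  assumes "a \<in> carrier A"
    and zero: "P \<zero>\<^bsub>A\<^esub>"
    and basis: "\<And>k g. k \<in> carrier K \<Longrightarrow> g \<in> carrier G \<Longrightarrow> P (k \<odot>\<^bsub>A\<^esub> bar g)"
    and add: "\<And>a b. a \<in> carrier A \<Longrightarrow> b \<in> carrier A \<Longrightarrow> P a \<Longrightarrow> P b \<Longrightarrow> P (a \<oplus>\<^bsub>A\<^esub> b)"
  shows "P a"
proof -
  have "P a" if "finite F" "a \<in> carrier A" "supp K G a \<subseteq> F" for F a
    using that
  proof (induct F arbitrary: a)
    case empty
    then have "a = \<zero>\<^bsub>A\<^esub>" by (intro A_ext) (auto simp: supp_def)
    then show ?case using zero by simp
  next
    case (insert g F)
    show ?case
    proof (cases "g \<in> carrier G")
      case True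
      define b where "b = (\<lambda>x\<in>carrier G. if x = g then \<zero> else a x)"
      have b: "b \<in> carrier A"
        unfolding b_def using insert.prems finite_supp
        by (intro A_memI[of "supp K G a"]) (auto simp: supp_def)
      have "a = a g \<odot>\<^bsub>A\<^esub> bar g \<oplus>\<^bsub>A\<^esub> b"
        using insert.prems b True by (intro A_ext) (auto simp: b_def bar_apply)
      moreover have "supp K G b \<subseteq> F" using insert.prems(2) by (auto simp: b_def supp_def)
      ultimately show ?thesis
        using insert.hyps(3)[OF b] insert.prems b True basis add by (metis A_coeff_closed A.smult_closed bar_closed)
    next
      case False
      then have "supp K G a \<subseteq> F" using insert.prems(2) by (auto simp: supp_def)
      then show ?thesis using insert by simp
    qed
  qed
  then show ?thesis using assms(1) finite_supp by blast
qed

text \<open>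
  Both sides are additive in each of the three factors. On basis elements they
  carry the scalars of the two sides of the cocycle identity.
\<close>

lemma A_assoc:
  assumes a: "a \<in> carrier A" and b: "b \<in> carrier A" and c: "c \<in> carrier A"
  shows "(a \<otimes>\<^bsub>A\<^esub> b) \<otimes>\<^bsub>A\<^esub> c = a \<otimes>\<^bsub>A\<^esub> (b \<otimes>\<^bsub>A\<^esub> c)"
proof -
  have null [simp]: "\<zero>\<^bsub>A\<^esub> \<otimes>\<^bsub>A\<^esub> a = \<zero>\<^bsub>A\<^esub>" "a \<otimes>\<^bsub>A\<^esub> \<zero>\<^bsub>A\<^esub> = \<zero>\<^bsub>A\<^esub>" if "a \<in> carrier A" for a
    using A_smult_l[of \<zero> "\<zero>\<^bsub>A\<^esub>" a] A_smult_r[of \<zero> a "\<zero>\<^bsub>A\<^esub>"] that mult_A_closed by simp_all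
  note [simp] = mult_A_closed A_distr_l A_distr_r A_smult_l A_smult_r bar_mult
  have assoc_bar: "(bar g \<otimes>\<^bsub>A\<^esub> bar h) \<otimes>\<^bsub>A\<^esub> bar l = bar g \<otimes>\<^bsub>A\<^esub> (bar h \<otimes>\<^bsub>A\<^esub> bar l)"
    if "g \<in> carrier G" "h \<in> carrier G" "l \<in> carrier G" for g h l
    using that by (simp add: A.smult_assoc1[symmetric] \<alpha>_cocycle G.m_assoc)
  show ?thesis using a
  proof (induct rule: A_induct)
    case (basis k g)
    show ?case using b
    proof (induct rule: A_induct)
      case (basis k' h)
      show ?case using c
      proof (induct rule: A_induct)
        case (basis k'' l)
        show ?case
          using basis \<open>k \<in> carrier K\<close> \<open>g \<in> carrier G\<close> \<open>k' \<in> carrier K\<close> \<open>h \<in> carrier G\<close>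
            assoc_bar[of g h l]
          by (simp del: bar_mult)
      qed (use basis \<open>k \<in> carrier K\<close> \<open>g \<in> carrier G\<close> in \<open>simp_all del: bar_mult\<close>)
    qed (use basis c in \<open>simp_all del: bar_mult\<close>)
  qed (use b c in simp_all)
qed

lemma mult_one_A:
  assumes "a \<in> carrier A"
  shows "a \<otimes>\<^bsub>A\<^esub> \<one>\<^bsub>A\<^esub> = a"
  using assms
proof (induct rule: A_induct)
  case zero
  show ?case using A_smult_l[of \<zero> "\<zero>\<^bsub>A\<^esub>" "\<one>\<^bsub>A\<^esub>"] mult_A_closed one_A by simp
qed (auto simp: A_distr_l A_smult_l bar_mult one_A)

sublocale A: ring A
  by (intro ringI monoidI abelian_group_A)
     (auto simp: A_distr_l A_distr_r A_assoc mult_A_closed one_A one_A_mult[unfolded one_A] mult_one_A[unfolded one_A])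

lemma A_mult_scalar:
  assumes "k \<in> carrier K" "a \<in> carrier A"
  shows "(k \<odot>\<^bsub>A\<^esub> \<one>\<^bsub>A\<^esub>) \<otimes>\<^bsub>A\<^esub> a = k \<odot>\<^bsub>A\<^esub> a" "a \<otimes>\<^bsub>A\<^esub> (k \<odot>\<^bsub>A\<^esub> \<one>\<^bsub>A\<^esub>) = k \<odot>\<^bsub>A\<^esub> a"
  using assms by (simp_all add: A_smult_l A_smult_r)

end

context twisted_group_algebra begin

section \<open>Derivations as homomorphisms into a group of dual numbers\<close>

text \<open>
  The pair \<open>(m, g)\<close> stands for the line spanned by \<open>bar g + \<epsilon> m\<close> in the dual numbers \<open>A[\<epsilon>]\<close>, where \<open>\<epsilon>\<^sup>2 = 0\<close>.
  The product \<open>(bar g + \<epsilon> m) (bar h + \<epsilon> n)\<close> is \<open>\<alpha> g h bar (g h) + \<epsilon> (m bar h + bar g n)\<close>, and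
  division by \<open>\<alpha> g h\<close> restores the normal form.
\<close>

definition dual_group :: "(('g \<Rightarrow> 'k) \<times> 'g) monoid" where
  "dual_group =
    \<lparr>carrier = carrier A \<times> carrier G,
     monoid.mult = (\<lambda>(m, g) (n, h).
       (inv (\<alpha> g h) \<odot>\<^bsub>A\<^esub> (m \<otimes>\<^bsub>A\<^esub> bar h \<oplus>\<^bsub>A\<^esub> bar g \<otimes>\<^bsub>A\<^esub> n), g \<otimes>\<^bsub>G\<^esub> h)),
     monoid.one = (\<zero>\<^bsub>A\<^esub>, \<one>\<^bsub>G\<^esub>)\<rparr>"

lemma dual_group_carrier [simp]: "(m, g) \<in> carrier dual_group \<longleftrightarrow> m \<in> carrier A \<and> g \<in> carrier G"
  by (simp add: dual_group_def)

lemma dual_group_mult [simp]: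
  "(m, g) \<otimes>\<^bsub>dual_group\<^esub> (n, h) =
    (inv (\<alpha> g h) \<odot>\<^bsub>A\<^esub> (m \<otimes>\<^bsub>A\<^esub> bar h \<oplus>\<^bsub>A\<^esub> bar g \<otimes>\<^bsub>A\<^esub> n), g \<otimes>\<^bsub>G\<^esub> h)"
  by (simp add: dual_group_def)

lemma dual_group_one: "\<one>\<^bsub>dual_group\<^esub> = (\<zero>\<^bsub>A\<^esub>, \<one>\<^bsub>G\<^esub>)"
  by (simp add: dual_group_def)

lemma \<alpha>_inv_closed [simp]: "x \<in> carrier G \<Longrightarrow> y \<in> carrier G \<Longrightarrow> inv (\<alpha> x y) \<in> carrier K"
  using \<alpha>_Units by simp

lemma \<alpha>_inv [simp]:
  assumes "x \<in> carrier G" "y \<in> carrier G"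
  shows "inv (\<alpha> x y) \<otimes> \<alpha> x y = \<one>" "\<alpha> x y \<otimes> inv (\<alpha> x y) = \<one>"
  using \<alpha>_Units[OF assms] by (simp_all add: Units_l_inv Units_r_inv)

lemma inv_mult_Units:
  assumes "a \<in> Units K" "b \<in> Units K"
  shows "inv (a \<otimes> b) = inv a \<otimes> inv b"
proof (rule comm_inv_char)
  have "(a \<otimes> b) \<otimes> (inv a \<otimes> inv b) = (a \<otimes> inv a) \<otimes> (b \<otimes> inv b)"
    using assms by (simp add: m_ac Units_closed del: Units_r_inv Units_l_inv)
  then show "(a \<otimes> b) \<otimes> (inv a \<otimes> inv b) = \<one>"
    using assms by (simp add: Units_r_inv)
qed (use assms Units_closed in auto)

lemma A_smult_commute:
  assumes "k \<in> carrier K" "l \<in> carrier K" "a \<in> carrier A"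
  shows "k \<odot>\<^bsub>A\<^esub> (l \<odot>\<^bsub>A\<^esub> a) = l \<odot>\<^bsub>A\<^esub> (k \<odot>\<^bsub>A\<^esub> a)"
  using assms by (simp add: A.smult_assoc1[symmetric] m_comm)

lemma \<alpha>_cocycle_inv:
  assumes "x \<in> carrier G" "y \<in> carrier G" "z \<in> carrier G"
  shows "inv (\<alpha> (x \<otimes>\<^bsub>G\<^esub> y) z) \<otimes> inv (\<alpha> x y) = inv (\<alpha> x (y \<otimes>\<^bsub>G\<^esub> z)) \<otimes> inv (\<alpha> y z)"
proof -
  have "inv (\<alpha> x y \<otimes> \<alpha> (x \<otimes>\<^bsub>G\<^esub> y) z) = inv (\<alpha> y z \<otimes> \<alpha> x (y \<otimes>\<^bsub>G\<^esub> z))"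
    using \<alpha>_cocycle assms by simp
  then show ?thesis using assms \<alpha>_Units by (simp add: inv_mult_Units m_comm)
qed

lemma bar_of_mult:
  assumes "g \<in> carrier G" "h \<in> carrier G"
  shows "bar (g \<otimes>\<^bsub>G\<^esub> h) = inv (\<alpha> g h) \<odot>\<^bsub>A\<^esub> (bar g \<otimes>\<^bsub>A\<^esub> bar h)"
  using assms by (simp add: bar_mult A.smult_assoc1[symmetric])

lemma bar_inverse_mult:
  assumes "g \<in> carrier G"
  shows "bar (inv\<^bsub>G\<^esub> g) \<otimes>\<^bsub>A\<^esub> bar g = \<alpha> (inv\<^bsub>G\<^esub> g) g \<odot>\<^bsub>A\<^esub> \<one>\<^bsub>A\<^esub>"
  using assms by (simp add: bar_mult one_A)

text \<open>
  The \<open>\<epsilon>\<close>-part of the inverse of \<open>bar g + \<epsilon> m\<close>, normalised so that its constant part is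
  \<open>bar (inv g)\<close>. With \<open>m = f s\<close> and \<open>g = \<iota> s\<close> it is the value of \<open>f\<^sup>*\<close> at the inverse letter of \<open>s\<close>.
\<close>

definition dual_inverse :: "('g \<Rightarrow> 'k) \<Rightarrow> 'g \<Rightarrow> ('g \<Rightarrow> 'k)" where
  "dual_inverse m g =
    (\<ominus> (inv (\<alpha> (inv\<^bsub>G\<^esub> g) g))) \<odot>\<^bsub>A\<^esub> (bar (inv\<^bsub>G\<^esub> g) \<otimes>\<^bsub>A\<^esub> m \<otimes>\<^bsub>A\<^esub> bar (inv\<^bsub>G\<^esub> g))"

lemma dual_inverse_closed [simp]:
  "m \<in> carrier A \<Longrightarrow> g \<in> carrier G \<Longrightarrow> dual_inverse m g \<in> carrier A"
  by (simp add: dual_inverse_def)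

lemma dual_inverse_mult:
  assumes "m \<in> carrier A" "g \<in> carrier G"
  shows "(dual_inverse m g, inv\<^bsub>G\<^esub> g) \<otimes>\<^bsub>dual_group\<^esub> (m, g) = \<one>\<^bsub>dual_group\<^esub>"
proof -
  let ?c = "\<alpha> (inv\<^bsub>G\<^esub> g) g"
  have "dual_inverse m g \<otimes>\<^bsub>A\<^esub> bar g =
      (\<ominus> (inv ?c)) \<odot>\<^bsub>A\<^esub> (bar (inv\<^bsub>G\<^esub> g) \<otimes>\<^bsub>A\<^esub> m \<otimes>\<^bsub>A\<^esub> (bar (inv\<^bsub>G\<^esub> g) \<otimes>\<^bsub>A\<^esub> bar g))"
    using assms by (simp add: dual_inverse_def A_smult_l A.m_assoc)
  also have "\<dots> = (\<ominus> (inv ?c)) \<odot>\<^bsub>A\<^esub> (?c \<odot>\<^bsub>A\<^esub> (bar (inv\<^bsub>G\<^esub> g) \<otimes>\<^bsub>A\<^esub> m))"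
    using assms by (simp add: bar_inverse_mult A_mult_scalar)
  also have "\<dots> = \<ominus>\<^bsub>A\<^esub> (bar (inv\<^bsub>G\<^esub> g) \<otimes>\<^bsub>A\<^esub> m)"
    using assms by (simp add: A.smult_l_minus A.smult_assoc1[symmetric] l_minus)
  finally have "dual_inverse m g \<otimes>\<^bsub>A\<^esub> bar g \<oplus>\<^bsub>A\<^esub> bar (inv\<^bsub>G\<^esub> g) \<otimes>\<^bsub>A\<^esub> m = \<zero>\<^bsub>A\<^esub>"
    using assms by (simp add: A.l_neg)
  then show ?thesis using assms by (simp add: dual_group_one)
qed

lemma group_dual_group: "group dual_group"
proof (rule groupI)
  fix x assume "x \<in> carrier dual_group"
  then obtain m g where x: "x = (m, g)" "m \<in> carrier A" "g \<in> carrier G"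
    by (cases x) auto
  show "\<one>\<^bsub>dual_group\<^esub> \<otimes>\<^bsub>dual_group\<^esub> x = x"
    using x by (simp add: dual_group_one flip: one_A)
  show "\<exists>y\<in>carrier dual_group. y \<otimes>\<^bsub>dual_group\<^esub> x = \<one>\<^bsub>dual_group\<^esub>"
    using x dual_inverse_mult by (intro bexI[of _ "(dual_inverse m g, inv\<^bsub>G\<^esub> g)"]) auto
next
  fix x y z assume "x \<in> carrier dual_group" "y \<in> carrier dual_group" "z \<in> carrier dual_group"
  then obtain m g n h p k where
    x: "x = (m, g)" "m \<in> carrier A" "g \<in> carrier G" and
    y: "y = (n, h)" "n \<in> carrier A" "h \<in> carrier G" and
    z: "z = (p, k)" "p \<in> carrier A" "k \<in> carrier G"
    by (cases x; cases y; cases z) auto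
  let ?s = "m \<otimes>\<^bsub>A\<^esub> bar h \<otimes>\<^bsub>A\<^esub> bar k \<oplus>\<^bsub>A\<^esub> (bar g \<otimes>\<^bsub>A\<^esub> n \<otimes>\<^bsub>A\<^esub> bar k \<oplus>\<^bsub>A\<^esub> bar g \<otimes>\<^bsub>A\<^esub> bar h \<otimes>\<^bsub>A\<^esub> p)"
  have "fst (x \<otimes>\<^bsub>dual_group\<^esub> y \<otimes>\<^bsub>dual_group\<^esub> z) =
      (inv (\<alpha> (g \<otimes>\<^bsub>G\<^esub> h) k) \<otimes> inv (\<alpha> g h)) \<odot>\<^bsub>A\<^esub> ?s"
    using x y z
    by (simp add: bar_of_mult A_smult_l A.l_distr A.smult_r_distr A.smult_assoc1 A.a_assoc)
  also have "\<dots> = (inv (\<alpha> g (h \<otimes>\<^bsub>G\<^esub> k)) \<otimes> inv (\<alpha> h k)) \<odot>\<^bsub>A\<^esub> ?s"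
    using x y z by (simp add: \<alpha>_cocycle_inv)
  also have "\<dots> = fst (x \<otimes>\<^bsub>dual_group\<^esub> (y \<otimes>\<^bsub>dual_group\<^esub> z))"
    using x y z
    by (simp add: bar_of_mult[of h k] A_smult_r A.r_distr A.smult_r_distr A.smult_assoc1 A.m_assoc)
  finally show "x \<otimes>\<^bsub>dual_group\<^esub> y \<otimes>\<^bsub>dual_group\<^esub> z = x \<otimes>\<^bsub>dual_group\<^esub> (y \<otimes>\<^bsub>dual_group\<^esub> z)"
    using x y z by (simp add: G.m_assoc)
qed (auto simp: dual_group_one)

lemma dual_group_inv:
  assumes "m \<in> carrier A" "g \<in> carrier G"
  shows "inv\<^bsub>dual_group\<^esub> (m, g) = (dual_inverse m g, inv\<^bsub>G\<^esub> g)"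
  using dual_inverse_mult[OF assms] assms
  by (intro group.inv_equality[OF group_dual_group]) auto

subsection \<open>From homomorphisms to derivations\<close>

definition linear_extension :: "('g \<Rightarrow> ('g \<Rightarrow> 'k)) \<Rightarrow> ('g \<Rightarrow> 'k) \<Rightarrow> ('g \<Rightarrow> 'k)" where
  "linear_extension D = (\<lambda>a\<in>carrier A. \<Oplus>\<^bsub>A\<^esub>g\<in>supp K G a. a g \<odot>\<^bsub>A\<^esub> D g)"

context
  fixes D assumes D: "\<And>g. g \<in> carrier G \<Longrightarrow> D g \<in> carrier A"
begin

text \<open>
  Enlarging the index set allows the values at two elements of \<open>A\<close> to be added term by term.
\<close>

lemma linear_extension_apply:
  assumes "a \<in> carrier A" "finite F" "supp K G a \<subseteq> F" "F \<subseteq> carrier G"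
  shows "linear_extension D a = (\<Oplus>\<^bsub>A\<^esub>g\<in>F. a g \<odot>\<^bsub>A\<^esub> D g)"
proof -
  have "(\<Oplus>\<^bsub>A\<^esub>g\<in>supp K G a. a g \<odot>\<^bsub>A\<^esub> D g) = (\<Oplus>\<^bsub>A\<^esub>g\<in>F. a g \<odot>\<^bsub>A\<^esub> D g)"
  proof (rule A.add.finprod_mono_neutral_cong_left)
    show "a g \<odot>\<^bsub>A\<^esub> D g = \<zero>\<^bsub>A\<^esub>" if "g \<in> F - supp K G a" for g
    proof -
      have "g \<in> carrier G" "a g = \<zero>" using that assms(4) by (auto simp: supp_def)
      then show ?thesis using D by simp
    qed
  qed (use assms D in \<open>auto simp: Pi_def subset_iff\<close>)
  then show ?thesis using assms(1) by (simp add: linear_extension_def)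
qed

lemma linear_extension_closed: "a \<in> carrier A \<Longrightarrow> linear_extension D a \<in> carrier A"
  using D supp_carrier by (auto simp: linear_extension_def Pi_def subset_iff intro!: A.finsum_closed)

lemma linear_extension_add:
  assumes "a \<in> carrier A" "b \<in> carrier A"
  shows "linear_extension D (a \<oplus>\<^bsub>A\<^esub> b) = linear_extension D a \<oplus>\<^bsub>A\<^esub> linear_extension D b"
proof -
  define F where "F = supp K G a \<union> supp K G b \<union> supp K G (a \<oplus>\<^bsub>A\<^esub> b)"
  have F: "finite F" "F \<subseteq> carrier G" "supp K G a \<subseteq> F" "supp K G b \<subseteq> F" "supp K G (a \<oplus>\<^bsub>A\<^esub> b) \<subseteq> F"
    using assms finite_supp supp_carrier by (auto simp: F_def)
  have t: "a g \<odot>\<^bsub>A\<^esub> D g \<in> carrier A" "b g \<odot>\<^bsub>A\<^esub> D g \<in> carrier A"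
    "(a \<oplus>\<^bsub>A\<^esub> b) g \<odot>\<^bsub>A\<^esub> D g = a g \<odot>\<^bsub>A\<^esub> D g \<oplus>\<^bsub>A\<^esub> b g \<odot>\<^bsub>A\<^esub> D g" if "g \<in> F" for g
    using subsetD[OF F(2) that] assms D by (auto simp: A.smult_l_distr)
  have "linear_extension D (a \<oplus>\<^bsub>A\<^esub> b) = (\<Oplus>\<^bsub>A\<^esub>g\<in>F. (a \<oplus>\<^bsub>A\<^esub> b) g \<odot>\<^bsub>A\<^esub> D g)"
    using linear_extension_apply[OF _ F(1,5,2)] assms by simp
  also have "\<dots> = (\<Oplus>\<^bsub>A\<^esub>g\<in>F. a g \<odot>\<^bsub>A\<^esub> D g \<oplus>\<^bsub>A\<^esub> b g \<odot>\<^bsub>A\<^esub> D g)"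
    using t by (intro A.finsum_cong') auto
  also have "\<dots> = (\<Oplus>\<^bsub>A\<^esub>g\<in>F. a g \<odot>\<^bsub>A\<^esub> D g) \<oplus>\<^bsub>A\<^esub> (\<Oplus>\<^bsub>A\<^esub>g\<in>F. b g \<odot>\<^bsub>A\<^esub> D g)"
    using t by (intro A.finsum_addf) auto
  finally show ?thesis
    using linear_extension_apply[OF assms(1) F(1,3,2)] linear_extension_apply[OF assms(2) F(1,4,2)] by simp
qed

lemma linear_extension_basis:
  assumes "k \<in> carrier K" "g \<in> carrier G"
  shows "linear_extension D (k \<odot>\<^bsub>A\<^esub> bar g) = k \<odot>\<^bsub>A\<^esub> D g"
proof -
  have "supp K G (k \<odot>\<^bsub>A\<^esub> bar g) \<subseteq> {g}"
    using assms by (auto simp: supp_def bar_apply split: if_splits)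
  then have "linear_extension D (k \<odot>\<^bsub>A\<^esub> bar g) = (\<Oplus>\<^bsub>A\<^esub>h\<in>{g}. (k \<odot>\<^bsub>A\<^esub> bar g) h \<odot>\<^bsub>A\<^esub> D h)"
    using assms by (intro linear_extension_apply) auto
  then show ?thesis using assms D by (simp add: bar_apply)
qed

lemma linear_extension_bar: "g \<in> carrier G \<Longrightarrow> linear_extension D (bar g) = D g"
  using linear_extension_basis[of \<one> g] D by simp

lemma linear_extension_zero: "linear_extension D \<zero>\<^bsub>A\<^esub> = \<zero>\<^bsub>A\<^esub>"
  using linear_extension_basis[of \<zero> "\<one>\<^bsub>G\<^esub>"] D by simp

text \<open>
  Both sides of the Leibniz rule are bilinear, so it is enough to know it for pairs of basis
  elements.
\<close>

lemma linear_extension_derivation: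
  assumes leibniz: "\<And>g h. g \<in> carrier G \<Longrightarrow> h \<in> carrier G \<Longrightarrow>
    \<alpha> g h \<odot>\<^bsub>A\<^esub> D (g \<otimes>\<^bsub>G\<^esub> h) = D g \<otimes>\<^bsub>A\<^esub> bar h \<oplus>\<^bsub>A\<^esub> bar g \<otimes>\<^bsub>A\<^esub> D h"
  shows "linear_extension D \<in> derivations A"
proof -
  note [simp] = linear_extension_closed linear_extension_add linear_extension_basis linear_extension_zero
    D A.l_distr A.r_distr
  have "linear_extension D (a \<otimes>\<^bsub>A\<^esub> b) =
      linear_extension D a \<otimes>\<^bsub>A\<^esub> b \<oplus>\<^bsub>A\<^esub> a \<otimes>\<^bsub>A\<^esub> linear_extension D b"
    if "a \<in> carrier A" and b: "b \<in> carrier A" for a b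
    using that(1)
  proof (induct rule: A_induct)
    case (basis k g)
    show ?case using b
    proof (induct rule: A_induct)
      case (basis k' h)
      note kg = \<open>k \<in> carrier K\<close> \<open>g \<in> carrier G\<close>
      have "linear_extension D ((k \<odot>\<^bsub>A\<^esub> bar g) \<otimes>\<^bsub>A\<^esub> (k' \<odot>\<^bsub>A\<^esub> bar h)) =
          linear_extension D ((k \<otimes> k' \<otimes> \<alpha> g h) \<odot>\<^bsub>A\<^esub> bar (g \<otimes>\<^bsub>G\<^esub> h))"
        using basis kg by (simp add: A_smult_l A_smult_r bar_mult A.smult_assoc1 A_smult_commute)
      also have "\<dots> = (k \<otimes> k') \<odot>\<^bsub>A\<^esub> (\<alpha> g h \<odot>\<^bsub>A\<^esub> D (g \<otimes>\<^bsub>G\<^esub> h))"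
        using basis kg linear_extension_basis[of "k \<otimes> k' \<otimes> \<alpha> g h" "g \<otimes>\<^bsub>G\<^esub> h"]
        by (simp add: A.smult_assoc1 del: linear_extension_basis)
      also have "\<dots> = (k \<otimes> k') \<odot>\<^bsub>A\<^esub> (D g \<otimes>\<^bsub>A\<^esub> bar h \<oplus>\<^bsub>A\<^esub> bar g \<otimes>\<^bsub>A\<^esub> D h)"
        using basis kg by (simp add: leibniz)
      finally show ?case
        using basis kg by (simp add: A_smult_l A_smult_r A.smult_assoc1 A.smult_r_distr A_smult_commute)
    next
      case (add a b)
      then show ?case using basis by (simp add: A.a_ac)
    qed (use basis in simp)
  next
    case (add a a')
    then show ?case using b by (simp add: A.a_ac)
  qed (use b in simp)
  moreover have "linear_extension D \<in> carrier A \<rightarrow>\<^sub>E carrier A"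
    using linear_extension_closed by (auto simp: linear_extension_def)
  ultimately show ?thesis by (simp add: derivations_def)
qed

end

subsection \<open>Derivations are linear\<close>

lemma derivationD:
  assumes "d \<in> derivations A"
  shows "a \<in> carrier A \<Longrightarrow> d a \<in> carrier A"
    and "a \<in> carrier A \<Longrightarrow> b \<in> carrier A \<Longrightarrow> d (a \<oplus>\<^bsub>A\<^esub> b) = d a \<oplus>\<^bsub>A\<^esub> d b"
    and "a \<in> carrier A \<Longrightarrow> b \<in> carrier A \<Longrightarrow> d (a \<otimes>\<^bsub>A\<^esub> b) = d a \<otimes>\<^bsub>A\<^esub> b \<oplus>\<^bsub>A\<^esub> a \<otimes>\<^bsub>A\<^esub> d b"
  using assms by (auto simp: derivations_def)

lemma derivation_undefined: "d \<in> derivations A \<Longrightarrow> a \<notin> carrier A \<Longrightarrow> d a = undefined"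
  unfolding derivations_def by (blast dest: PiE_arb)

lemma derivation_zero:
  assumes "d \<in> derivations A"
  shows "d \<zero>\<^bsub>A\<^esub> = \<zero>\<^bsub>A\<^esub>"
  using derivationD(1)[OF assms, of "\<zero>\<^bsub>A\<^esub>"] derivationD(3)[OF assms, of "\<zero>\<^bsub>A\<^esub>" "\<zero>\<^bsub>A\<^esub>"]
  by simp

text \<open>
  The map \<open>c \<mapsto> d (c 1)\<close> satisfies the Leibniz rule over \<open>K\<close> because scalar multiples of 1 are central.
  Its coefficient at each \<open>x\<close> is thus a derivation of the field \<open>K\<close> and vanishes, which
  gives \<open>d (c a) = d (c 1) a + c d a = c d a\<close>.
\<close>

lemma derivation_linear:
  assumes d: "d \<in> derivations A" and K: "algebraic_over_prime_field K"
    and k: "k \<in> carrier K" and a: "a \<in> carrier A"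
  shows "d (k \<odot>\<^bsub>A\<^esub> a) = k \<odot>\<^bsub>A\<^esub> d a"
proof -
  note d = derivationD[OF d]
  have "d (k \<odot>\<^bsub>A\<^esub> \<one>\<^bsub>A\<^esub>) x = \<zero>" if x: "x \<in> carrier G" for x
  proof -
    interpret \<delta>: field_derivation K "\<lambda>c. d (c \<odot>\<^bsub>A\<^esub> \<one>\<^bsub>A\<^esub>) x"
    proof
      fix b c assume b: "b \<in> carrier K" and c: "c \<in> carrier K"
      show "d ((b \<oplus> c) \<odot>\<^bsub>A\<^esub> \<one>\<^bsub>A\<^esub>) x = d (b \<odot>\<^bsub>A\<^esub> \<one>\<^bsub>A\<^esub>) x \<oplus> d (c \<odot>\<^bsub>A\<^esub> \<one>\<^bsub>A\<^esub>) x"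
        using b c x d by (simp add: A.smult_l_distr)
      have "d ((b \<otimes> c) \<odot>\<^bsub>A\<^esub> \<one>\<^bsub>A\<^esub>) = d ((b \<odot>\<^bsub>A\<^esub> \<one>\<^bsub>A\<^esub>) \<otimes>\<^bsub>A\<^esub> (c \<odot>\<^bsub>A\<^esub> \<one>\<^bsub>A\<^esub>))"
        using b c by (simp add: A_mult_scalar A.smult_assoc1 A_smult_commute)
      also have "\<dots> = c \<odot>\<^bsub>A\<^esub> d (b \<odot>\<^bsub>A\<^esub> \<one>\<^bsub>A\<^esub>) \<oplus>\<^bsub>A\<^esub> b \<odot>\<^bsub>A\<^esub> d (c \<odot>\<^bsub>A\<^esub> \<one>\<^bsub>A\<^esub>)"
        using b c d(1) by (subst d(3)) (simp_all add: A_mult_scalar)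
      finally show "d ((b \<otimes> c) \<odot>\<^bsub>A\<^esub> \<one>\<^bsub>A\<^esub>) x =
          d (b \<odot>\<^bsub>A\<^esub> \<one>\<^bsub>A\<^esub>) x \<otimes> c \<oplus> b \<otimes> d (c \<odot>\<^bsub>A\<^esub> \<one>\<^bsub>A\<^esub>) x"
        using b c x d by (simp add: m_comm)
    qed (use x d in simp)
    show ?thesis using \<delta>.der_vanishes[OF K k] .
  qed
  then have "d (k \<odot>\<^bsub>A\<^esub> \<one>\<^bsub>A\<^esub>) = \<zero>\<^bsub>A\<^esub>"
    using k d by (intro A_ext) auto
  moreover have "d ((k \<odot>\<^bsub>A\<^esub> \<one>\<^bsub>A\<^esub>) \<otimes>\<^bsub>A\<^esub> a) =
      d (k \<odot>\<^bsub>A\<^esub> \<one>\<^bsub>A\<^esub>) \<otimes>\<^bsub>A\<^esub> a \<oplus>\<^bsub>A\<^esub> (k \<odot>\<^bsub>A\<^esub> \<one>\<^bsub>A\<^esub>) \<otimes>\<^bsub>A\<^esub> d a"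
    using k a by (intro d(3)) auto
  ultimately show ?thesis using k a d(1) by (simp add: A_mult_scalar)
qed

text \<open>
  By linearity \<open>\<alpha> g h d (bar (g h)) = d (bar g bar h)\<close>, and the Leibniz rule turns the right-hand side
  into the product of \<open>dual_group\<close>.
\<close>

lemma derivation_hom:
  assumes d: "d \<in> derivations A" and K: "algebraic_over_prime_field K"
  shows "(\<lambda>g. (d (bar g), g)) \<in> hom G dual_group"
proof (rule homI)
  note d' = derivationD[OF d]
  fix g h assume g: "g \<in> carrier G" and h: "h \<in> carrier G"
  show "(d (bar g), g) \<in> carrier dual_group" using g d' by simp
  have "d (bar (g \<otimes>\<^bsub>G\<^esub> h)) = inv (\<alpha> g h) \<odot>\<^bsub>A\<^esub> d (bar g \<otimes>\<^bsub>A\<^esub> bar h)"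
    using g h by (simp add: bar_of_mult derivation_linear[OF d K])
  then show "(d (bar (g \<otimes>\<^bsub>G\<^esub> h)), g \<otimes>\<^bsub>G\<^esub> h) = (d (bar g), g) \<otimes>\<^bsub>dual_group\<^esub> (d (bar h), h)"
    using g h d' by simp
qed

section \<open>The formula for the values on words\<close>

context
  fixes S :: "'s set" and \<iota> :: "'s \<Rightarrow> 'g" and f :: "'s \<Rightarrow> 'g \<Rightarrow> 'k"
  assumes \<iota>: "\<iota> \<in> S \<rightarrow> carrier G" and f: "f \<in> S \<rightarrow> carrier A"
begin

interpretation G: word_evaluation G S \<iota>
  by unfold_locales (rule \<iota>)

abbreviation dual_gen :: "'s \<Rightarrow> ('g \<Rightarrow> 'k) \<times> 'g" where
  "dual_gen s \<equiv> (f s, \<iota> s)"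

lemma word_evaluation_dual_group: "word_evaluation dual_group S dual_gen"
  using \<iota> f group_dual_group
  by (auto simp: word_evaluation_def word_evaluation_axioms_def Pi_def)

interpretation dual: word_evaluation dual_group S dual_gen
  by (rule word_evaluation_dual_group)

text \<open>
  This explains the case of inverse letters in the definition of \<open>f\<^sup>*\<close>: it is inversion in
  \<open>dual_group\<close>.
\<close>

lemma letter_val_dual_group:
  assumes "x \<in> letters S"
  shows "letter_val dual_group dual_gen x = (fstar_letter K G \<alpha> \<iota> f x, letter_val G \<iota> x)"
  using assms \<iota> f by (cases x) (auto simp: dual_group_inv dual_inverse_def Let_def Pi_def)

lemma fstar_letter_closed [simp]: "x \<in> letters S \<Longrightarrow> fstar_letter K G \<alpha> \<iota> f x \<in> carrier A"
  using dual.letter_val_closed[of x] by (simp add: letter_val_dual_group)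

lemma letter_bar_closed [simp]: "letter_bar K G \<iota> x \<in> carrier A"
  by (simp add: letter_bar_def)

lemma word_beta_Nil [simp]: "word_beta K G \<alpha> \<iota> [] = \<one>"
  by (simp add: word_beta_def)

lemma word_beta_Cons:
  assumes "x \<in> letters S" "w \<in> words S"
  shows "word_beta K G \<alpha> \<iota> (x # w) = \<alpha> (letter_val G \<iota> x) (word_val G \<iota> w) \<otimes> word_beta K G \<alpha> \<iota> w"
proof (cases w)
  case Nil
  then show ?thesis using assms by (simp add: word_beta_def)
next
  case (Cons y v)
  let ?t = "\<lambda>w i. \<alpha> (letter_val G \<iota> (w ! i)) (word_val G \<iota> (drop (Suc i) w))"
  have t: "?t w i \<in> carrier K" if "i < length w" for i
  proof -
    have "w ! i \<in> letters S" "drop (Suc i) w \<in> words S"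
      using assms that by (auto simp: words_def lists_eq_set dest: in_set_dropD)
    then show ?thesis by simp
  qed
  have "word_beta K G \<alpha> \<iota> (x # w) = (\<Otimes>i\<in>insert 0 (Suc ` {..<length w - 1}). ?t (x # w) i)"
    using Cons by (simp add: word_beta_def lessThan_Suc_eq_insert_0)
  also have "\<dots> = ?t (x # w) 0 \<otimes> (\<Otimes>i\<in>Suc ` {..<length w - 1}. ?t (x # w) i)"
    using t assms by (intro finprod_insert) auto
  also have "(\<Otimes>i\<in>Suc ` {..<length w - 1}. ?t (x # w) i) = (\<Otimes>i\<in>{..<length w - 1}. ?t w i)"
    using t by (subst finprod_reindex) auto
  finally show ?thesis by (simp add: word_beta_def)
qed

lemma word_beta_Units: "w \<in> words S \<Longrightarrow> word_beta K G \<alpha> \<iota> w \<in> Units K"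
  by (induct w) (auto simp: word_beta_Cons intro!: Units_m_closed \<alpha>_Units)

lemma word_beta_closed [simp]: "w \<in> words S \<Longrightarrow> word_beta K G \<alpha> \<iota> w \<in> carrier K"
  using word_beta_Units Units_closed by blast

lemma list_mult_Cons [simp]: "list_mult M (x # xs) = x \<otimes>\<^bsub>M\<^esub> list_mult M xs"
  and list_mult_Nil [simp]: "list_mult M [] = \<one>\<^bsub>M\<^esub>"
  by (simp_all add: list_mult_def)

lemma list_mult_letter_bar:
  "w \<in> words S \<Longrightarrow>
    list_mult A (map (letter_bar K G \<iota>) w) = word_beta K G \<alpha> \<iota> w \<odot>\<^bsub>A\<^esub> bar (word_val G \<iota> w)"
proof (induct w)
  case (Cons x w)
  then show ?case
    by (simp add: word_beta_Cons letter_bar_def A_smult_r bar_mult A.smult_assoc1 A_smult_commute)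
qed (simp add: one_A)

text \<open>
  The sum in the definition of \<open>f\<^sup>*\<close> before division by \<open>\<beta>\<close>. It makes sense for words of length 0 and 1
  too, and this permits an induction over all words.
\<close>

definition leibniz_sum :: "'s letter list \<Rightarrow> ('g \<Rightarrow> 'k)" where
  "leibniz_sum w = (\<Oplus>\<^bsub>A\<^esub>i\<in>{..<length w}.
      list_mult A (map (letter_bar K G \<iota>) (take i w)) \<otimes>\<^bsub>A\<^esub>
      fstar_letter K G \<alpha> \<iota> f (w ! i) \<otimes>\<^bsub>A\<^esub>
      list_mult A (map (letter_bar K G \<iota>) (drop (Suc i) w)))"

lemma list_mult_letter_bar_closed [simp]:
  "list_mult A (map (letter_bar K G \<iota>) w) \<in> carrier A"
  by (induct w) auto

lemma leibniz_sum_Cons: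
  assumes "x \<in> letters S" "w \<in> words S"
  shows "leibniz_sum (x # w) =
    fstar_letter K G \<alpha> \<iota> f x \<otimes>\<^bsub>A\<^esub> list_mult A (map (letter_bar K G \<iota>) w) \<oplus>\<^bsub>A\<^esub>
    letter_bar K G \<iota> x \<otimes>\<^bsub>A\<^esub> leibniz_sum w"
proof -
  let ?t = "\<lambda>w i. list_mult A (map (letter_bar K G \<iota>) (take i w)) \<otimes>\<^bsub>A\<^esub>
      fstar_letter K G \<alpha> \<iota> f (w ! i) \<otimes>\<^bsub>A\<^esub> list_mult A (map (letter_bar K G \<iota>) (drop (Suc i) w))"
  have t: "?t v i \<in> carrier A" if "v \<in> words S" "i < length v" for v i
  proof -
    have "v ! i \<in> letters S" using that by (auto simp: words_def lists_eq_set)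
    then show ?thesis by simp
  qed
  have xw: "x # w \<in> words S" using assms by simp
  have "leibniz_sum (x # w) = (\<Oplus>\<^bsub>A\<^esub>i\<in>insert 0 (Suc ` {..<length w}). ?t (x # w) i)"
    by (simp add: leibniz_sum_def lessThan_Suc_eq_insert_0)
  also have "\<dots> = ?t (x # w) 0 \<oplus>\<^bsub>A\<^esub> (\<Oplus>\<^bsub>A\<^esub>i\<in>Suc ` {..<length w}. ?t (x # w) i)"
    using t[OF xw] assms by (intro A.finsum_insert) auto
  also have "(\<Oplus>\<^bsub>A\<^esub>i\<in>Suc ` {..<length w}. ?t (x # w) i) = (\<Oplus>\<^bsub>A\<^esub>i\<in>{..<length w}. ?t (x # w) (Suc i))"
    using t[OF xw] by (intro A.finsum_reindex) auto
  also have "\<dots> = (\<Oplus>\<^bsub>A\<^esub>i\<in>{..<length w}. letter_bar K G \<iota> x \<otimes>\<^bsub>A\<^esub> ?t w i)"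
  proof (rule A.finsum_cong')
    fix i assume "i \<in> {..<length w}"
    then have "w ! i \<in> letters S" using assms(2) by (auto simp: words_def lists_eq_set)
    then show "?t (x # w) (Suc i) = letter_bar K G \<iota> x \<otimes>\<^bsub>A\<^esub> ?t w i" by (simp add: A.m_assoc)
  qed (use t assms in auto)
  also have "\<dots> = letter_bar K G \<iota> x \<otimes>\<^bsub>A\<^esub> leibniz_sum w"
    unfolding leibniz_sum_def using t assms by (intro A.finsum_rdistr[symmetric]) auto
  finally show ?thesis using assms by simp
qed

text \<open>
  Multiply out, in \<open>A[\<epsilon>]\<close>, the elements \<open>bar x + \<epsilon> f\<^sup>* x\<close> for the letters \<open>x\<close> of a word \<open>w\<close>. The
  \<open>\<epsilon>\<close>-part of the result is \<open>leibniz_sum w\<close>, and the constant part is \<open>\<beta>\<close> times a basis element,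
  so division by \<open>\<beta>\<close> gives the normal form.
\<close>

lemma leibniz_sum_dual_group:
  assumes "w \<in> words S"
  shows "snd (word_val dual_group dual_gen w) = word_val G \<iota> w"
    and "leibniz_sum w = word_beta K G \<alpha> \<iota> w \<odot>\<^bsub>A\<^esub> fst (word_val dual_group dual_gen w)"
proof -
  have "snd (word_val dual_group dual_gen w) = word_val G \<iota> w \<and>
    leibniz_sum w = word_beta K G \<alpha> \<iota> w \<odot>\<^bsub>A\<^esub> fst (word_val dual_group dual_gen w)"
    using assms
  proof (induct w)
    case Nil
    then show ?case by (simp add: dual_group_one leibniz_sum_def)
  next
    case (Cons x w)
    then have x: "x \<in> letters S" and w: "w \<in> words S" by auto
    define m where "m = fst (word_val dual_group dual_gen w)"
    have m: "word_val dual_group dual_gen w = (m, word_val G \<iota> w)"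
      using Cons.hyps[OF w] by (simp add: m_def prod_eq_iff)
    have mA: "m \<in> carrier A" using dual.word_val_closed[OF w] m by simp
    let ?g = "letter_val G \<iota> x" and ?h = "word_val G \<iota> w" and ?b = "word_beta K G \<alpha> \<iota> w"
    let ?s = "fstar_letter K G \<alpha> \<iota> f x \<otimes>\<^bsub>A\<^esub> bar ?h \<oplus>\<^bsub>A\<^esub> bar ?g \<otimes>\<^bsub>A\<^esub> m"
    have val: "word_val dual_group dual_gen (x # w) = (inv (\<alpha> ?g ?h) \<odot>\<^bsub>A\<^esub> ?s, ?g \<otimes>\<^bsub>G\<^esub> ?h)"
      using x m by (simp add: letter_val_dual_group)
    have "leibniz_sum (x # w) = ?b \<odot>\<^bsub>A\<^esub> ?s"
      using x w mA m Cons
      by (simp add: leibniz_sum_Cons list_mult_letter_bar A_smult_r A.smult_r_distr letter_bar_def)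
    also have "\<dots> = (\<alpha> ?g ?h \<otimes> ?b) \<odot>\<^bsub>A\<^esub> (inv (\<alpha> ?g ?h) \<odot>\<^bsub>A\<^esub> ?s)"
    proof -
      have "\<alpha> ?g ?h \<otimes> ?b \<otimes> inv (\<alpha> ?g ?h) = ?b \<otimes> (\<alpha> ?g ?h \<otimes> inv (\<alpha> ?g ?h))"
        using x w by (simp add: m_ac del: \<alpha>_inv)
      then show ?thesis using x w mA by (simp add: A.smult_assoc1[symmetric])
    qed
    finally show ?case using val x w by (simp add: word_beta_Cons)
  qed
  then show "snd (word_val dual_group dual_gen w) = word_val G \<iota> w"
    and "leibniz_sum w = word_beta K G \<alpha> \<iota> w \<odot>\<^bsub>A\<^esub> fst (word_val dual_group dual_gen w)"
    by auto
qed

text \<open>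
  For words of length at most 1 the scalar \<open>\<beta>\<close> is an empty product, so the separate cases in the
  definition of \<open>f\<^sup>*\<close> agree with the general formula.
\<close>

lemma fstar_leibniz_sum:
  assumes "w \<in> words S"
  shows "fstar K G \<alpha> \<iota> f w = inv (word_beta K G \<alpha> \<iota> w) \<odot>\<^bsub>A\<^esub> leibniz_sum w"
  using assms
proof (induct w rule: induct_list012)
  case 1
  show ?case by (simp add: leibniz_sum_def)
next
  case (2 x)
  then show ?case by (simp add: leibniz_sum_Cons word_beta_Cons) (simp add: leibniz_sum_def)
next
  case (3 x y z)
  show ?case by (simp add: leibniz_sum_def Let_def)
qed

theorem word_val_dual_group:
  assumes "w \<in> words S"
  shows "word_val dual_group dual_gen w = (fstar K G \<alpha> \<iota> f w, word_val G \<iota> w)"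
proof -
  have "fst (word_val dual_group dual_gen w) \<in> carrier A"
    using dual.word_val_closed[OF assms] by (cases "word_val dual_group dual_gen w") simp
  then have "fstar K G \<alpha> \<iota> f w = fst (word_val dual_group dual_gen w)"
    using assms word_beta_Units
    by (simp add: fstar_leibniz_sum leibniz_sum_dual_group(2) A.smult_assoc1[symmetric])
  then show ?thesis using leibniz_sum_dual_group(1)[OF assms] by (simp add: prod_eq_iff)
qed

end

end

theorem mainTheorem5:
  fixes G :: "('g, 'm) monoid_scheme"
    and S :: "'s set"
    and \<iota> :: "'s \<Rightarrow> 'g"
    and T :: "'s letter list set"
    and K :: "('k, 'n) ring_scheme"
    and \<alpha> :: "'g \<Rightarrow> 'g \<Rightarrow> 'k"
    and f :: "'s \<Rightarrow> 'g \<Rightarrow> 'k"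
  assumes "group G"
    and "presentation G S \<iota> T"
    and "field K"
    and "algebraic_over_prime_field K"
    and "normalized_cocycle K G \<alpha>"
    and "f \<in> S \<rightarrow> carrier (twisted_group_ring K G \<alpha>)"
  shows "(\<forall>d \<in> extending_derivations K G \<alpha> S \<iota> f.
            (\<forall>d' \<in> extending_derivations K G \<alpha> S \<iota> f. d' = d) \<and>
            (\<forall>c \<in> carrier K. \<forall>a \<in> carrier (twisted_group_ring K G \<alpha>).
               d (c \<odot>\<^bsub>twisted_group_ring K G \<alpha>\<^esub> a) = c \<odot>\<^bsub>twisted_group_ring K G \<alpha>\<^esub> d a) \<and>
            (\<forall>g \<in> carrier G. \<forall>w \<in> words S. word_val G \<iota> w = g \<longrightarrow>
               d (tbasis K G g) = fstar K G \<alpha> \<iota> f w)) \<and>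
         ((\<exists>d. d \<in> extending_derivations K G \<alpha> S \<iota> f) \<longleftrightarrow>
            (\<forall>t \<in> T. fstar K G \<alpha> \<iota> f t = \<zero>\<^bsub>twisted_group_ring K G \<alpha>\<^esub>))"
proof -
  interpret twisted_group_algebra K G \<alpha>
    using assms by (simp add: twisted_group_algebra_def twisted_group_algebra_axioms_def)
  interpret presented_group G S \<iota> T
    using assms by (simp add: presented_group_def presented_group_axioms_def)
  note f = \<open>f \<in> S \<rightarrow> carrier A\<close> and K = \<open>algebraic_over_prime_field K\<close>
  interpret dual: word_evaluation dual_group S "\<lambda>s. (f s, \<iota> s)"
    using word_evaluation_dual_group[OF generators_closed f] .
  note word_val_dual = word_val_dual_group[OF generators_closed f]
  let ?E = "extending_derivations K G \<alpha> S \<iota> f"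
  have der: "d \<in> derivations A" and ext: "\<And>s. s \<in> S \<Longrightarrow> d (bar (\<iota> s)) = f s" if "d \<in> ?E" for d
    using that by (simp_all add: extending_derivations_def)
  have value_on_word: "d (bar (word_val G \<iota> w)) = fstar K G \<alpha> \<iota> f w" if d: "d \<in> ?E" and w: "w \<in> words S" for d w
  proof -
    have "(d (bar (word_val G \<iota> w)), word_val G \<iota> w) =
        word_val dual_group ((\<lambda>g. (d (bar g), g)) \<circ> \<iota>) w"
      using hom_word_val[OF group_dual_group derivation_hom[OF der[OF d] K] w] by simp
    also have "\<dots> = word_val dual_group (\<lambda>s. (f s, \<iota> s)) w"
      using ext[OF d] w by (intro word_val_cong[of S]) simp_all
    finally show ?thesis using word_val_dual[OF w] by simp
  qed
  have unique: "d' = d" if d: "d \<in> ?E" and d': "d' \<in> ?E" for d d'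
  proof
    fix a
    show "d' a = d a"
    proof (cases "a \<in> carrier A")
      case True
      then show ?thesis
      proof (induct rule: A_induct)
        case zero
        show ?case using derivation_zero[OF der[OF d]] derivation_zero[OF der[OF d']] by simp
      next
        case (basis k g)
        obtain w where w: "w \<in> words S" "word_val G \<iota> w = g" using generated[OF basis(2)] .
        then have "d' (bar g) = d (bar g)"
          using value_on_word[OF d w(1)] value_on_word[OF d' w(1)] by simp
        then show ?case
          using basis derivation_linear[OF der[OF d] K] derivation_linear[OF der[OF d'] K] by simp
      next
        case (add a b)
        then show ?case using derivationD(2)[OF der[OF d]] derivationD(2)[OF der[OF d']] by simp
      qed
    next
      case False
      then show ?thesis
        using derivation_undefined[OF der[OF d]] derivation_undefined[OF der[OF d']] by simp
    qed
  qed
  have necessary: "fstar K G \<alpha> \<iota> f t = \<zero>\<^bsub>A\<^esub>" if d: "d \<in> ?E" and t: "t \<in> T" for d t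
  proof -
    have "(d (bar \<one>\<^bsub>G\<^esub>), \<one>\<^bsub>G\<^esub>) = \<one>\<^bsub>dual_group\<^esub>"
      using hom_one[OF derivation_hom[OF der[OF d] K] G.group_axioms group_dual_group] .
    moreover have "d (bar \<one>\<^bsub>G\<^esub>) = fstar K G \<alpha> \<iota> f t"
      using value_on_word[OF d subsetD[OF relators_words t]] relator_val[OF t] by simp
    ultimately show ?thesis by (simp add: dual_group_one)
  qed
  have sufficient: "\<exists>d. d \<in> ?E" if T: "\<And>t. t \<in> T \<Longrightarrow> fstar K G \<alpha> \<iota> f t = \<zero>\<^bsub>A\<^esub>"
  proof -
    have relators_killed: "word_val dual_group (\<lambda>s. (f s, \<iota> s)) t = \<one>\<^bsub>dual_group\<^esub>" if t: "t \<in> T" for t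
      using T[OF t] relator_val[OF t] word_val_dual[OF subsetD[OF relators_words t]]
      by (simp add: dual_group_one)
    obtain \<theta> where \<theta>: "\<theta> \<in> hom G dual_group"
      "\<forall>w\<in>words S. \<theta> (word_val G \<iota> w) = word_val dual_group (\<lambda>s. (f s, \<iota> s)) w"
      using hom_from_presentation[OF dual.word_evaluation_axioms relators_killed] .
    define D where "D g = fst (\<theta> g)" for g
    have \<theta>_D: "\<theta> g = (D g, g)" "D g \<in> carrier A" if g: "g \<in> carrier G" for g
    proof -
      obtain w where w: "w \<in> words S" "word_val G \<iota> w = g" using generated[OF g] .
      show "\<theta> g = (D g, g)" using \<theta>(2)[rule_format, OF w(1)] w word_val_dual[OF w(1)] by (simp add: D_def)
      moreover have "\<theta> g \<in> carrier dual_group" using \<theta>(1) g by (rule hom_in_carrier)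
      ultimately show "D g \<in> carrier A" by simp
    qed
    have leibniz: "\<alpha> g h \<odot>\<^bsub>A\<^esub> D (g \<otimes>\<^bsub>G\<^esub> h) = D g \<otimes>\<^bsub>A\<^esub> bar h \<oplus>\<^bsub>A\<^esub> bar g \<otimes>\<^bsub>A\<^esub> D h"
      if g: "g \<in> carrier G" and h: "h \<in> carrier G" for g h
    proof -
      have "\<theta> (g \<otimes>\<^bsub>G\<^esub> h) = \<theta> g \<otimes>\<^bsub>dual_group\<^esub> \<theta> h" using \<theta>(1) g h by (simp add: hom_mult)
      then have "D (g \<otimes>\<^bsub>G\<^esub> h) = inv\<^bsub>K\<^esub> (\<alpha> g h) \<odot>\<^bsub>A\<^esub> (D g \<otimes>\<^bsub>A\<^esub> bar h \<oplus>\<^bsub>A\<^esub> bar g \<otimes>\<^bsub>A\<^esub> D h)"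
        using g h \<theta>_D by simp
      then show ?thesis using g h \<theta>_D(2) by (simp add: A.smult_assoc1[symmetric])
    qed
    have "linear_extension D \<in> derivations A"
      by (rule linear_extension_derivation[of D, OF \<theta>_D(2) leibniz])
    moreover have "linear_extension D (bar (\<iota> s)) = f s" if s: "s \<in> S" for s
    proof -
      have w: "[Gen s] \<in> words S" and g: "\<iota> s \<in> carrier G" using s by simp_all
      have val: "word_val G \<iota> [Gen s] = \<iota> s" using g by simp
      have "\<theta> (\<iota> s) = (f s, \<iota> s)"
        using bspec[OF \<theta>(2) w] word_val_dual[OF w] unfolding val fstar.simps fstar_letter.simps
        by (rule HOL.trans)
      then have "D (\<iota> s) = f s" by (simp add: D_def)
      then show ?thesis using linear_extension_bar[OF \<theta>_D(2) g] by simp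
    qed
    ultimately show ?thesis unfolding extending_derivations_def by blast
  qed
  show ?thesis
  proof (intro conjI ballI impI iffI)
    show "d' = d" if "d \<in> ?E" "d' \<in> ?E" for d d' using that by (rule unique)
    show "d (c \<odot>\<^bsub>A\<^esub> a) = c \<odot>\<^bsub>A\<^esub> d a" if "d \<in> ?E" "c \<in> carrier K" "a \<in> carrier A" for d c a
      using derivation_linear[OF der[OF that(1)] K that(2,3)] .
    show "d (bar g) = fstar K G \<alpha> \<iota> f w" if "d \<in> ?E" "w \<in> words S" "word_val G \<iota> w = g" for d g w
      using value_on_word[OF that(1,2)] that(3) by simp
    show "fstar K G \<alpha> \<iota> f t = \<zero>\<^bsub>A\<^esub>" if "\<exists>d. d \<in> ?E" "t \<in> T" for t
      using that(1) by (elim exE) (rule necessary[OF _ that(2)])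
    show "\<exists>d. d \<in> ?E" if "\<forall>t\<in>T. fstar K G \<alpha> \<iota> f t = \<zero>\<^bsub>A\<^esub>"
      by (rule sufficient) (rule bspec[OF that])
  qed
qed

end
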